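(* Let $N,k\ge1$ be integers, write $z=(x,y)\in\mathbb{R}^{N}\times\mathbb{R}^k$, and let $\Delta_{\mathcal{G}}=\Delta_x+|x|^2\Delta_y$. Let $0\le\gamma<1$, $p>1$, and let $u_0\in C_0(\mathbb{R}^{N+k})$ with $u_0\ge0$, $u_0\not\equiv0$. If $p\gamma\le1$, then the problem $$u_t-\Delta_{\mathcal{G}}u=\int_0^t(t-s)^{-\gamma}|u|^{p-1}u(s)\,ds\ \text{ in }\mathbb{R}^{N+k}\times(0,\infty),\qquad u(z,0)=u_0(z),$$ admits no global nonnegative weak solution $u\in C([0,\infty),C_0(\mathbb{R}^{N+k}))$.
   Context: $C_0(\mathbb{R}^{N+k})$ denotes continuous functions vanishing at infinity. For $T>0$, a function $u$ is a weak solution on $[0,T]$ if $u$, $\int_0^t(t-s)^{-\gamma}|u|^{p-1}u(s)\,ds\in L^1_{\mathrm{loc}}(\mathbb{R}^{N+k}\times(0,T))$ and for every compactly supported $\varphi\in C^{2,1}(\mathbb{R}^{N+k}\times[0,T])$ with $\varphi(\cdot,T)=0$, $$-\int_{\mathbb{R}^{N+k}}u_0\varphi(z,0)\,dz=\int_0^T\!\!\int_{\mathbb{R}^{N+k}}\Big(\int_0^t(t-s)^{-\gamma}|u|^{p-1}u(z,s)\,ds\Big)\varphi\,dz\,dt+\int_0^T\!\!\int_{\mathbb{R}^{N+k}}u\,\Delta_{\mathcal{G}}\varphi\,dz\,dt+\int_0^T\!\!\int_{\mathbb{R}^{N+k}}u\,\varphi_t\,dz\,dt.$$ A global weak solution is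 a weak solution on $[0,T]$ for every $T>0$. *)

theory Defs
  imports "HOL-Analysis.Analysis"
begin

text \<open>Points of R^(N+k) are pairs z = (x,y) with x :: real^'n, y :: real^'k;
  the dimensions N = CARD('n) and k = CARD('k) are at least 1 automatically.\<close>

definition C0 :: "('a::real_normed_vector \<Rightarrow> real) \<Rightarrow> bool" where
  "C0 f \<longleftrightarrow> continuous_on UNIV f \<and> (f \<longlongrightarrow> 0) at_infinity"

definition C0_path :: "('a::real_normed_vector \<Rightarrow> real \<Rightarrow> real) \<Rightarrow> bool" where
  "C0_path u \<longleftrightarrow> (\<forall>t\<ge>0. C0 (\<lambda>z. u z t)) \<and>
     (\<forall>t\<ge>0. \<forall>e>0. \<exists>d>0. \<forall>s\<ge>0. \<bar>s - t\<bar> < d \<longrightarrow> (\<forall>z. \<bar>u z s - u z t\<bar> \<le> e))"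

definition locally_L1 :: "('a::euclidean_space) set \<Rightarrow> ('a \<Rightarrow> real) \<Rightarrow> bool" where
  "locally_L1 S f \<longleftrightarrow> (\<forall>K. compact K \<and> K \<subseteq> S \<longrightarrow> set_integrable lborel K f)"

definition C21 :: "real \<Rightarrow> ('a::euclidean_space \<Rightarrow> real \<Rightarrow> real) \<Rightarrow> ('a \<Rightarrow> 'a \<Rightarrow> real \<Rightarrow> real)
    \<Rightarrow> ('a \<Rightarrow> 'a \<Rightarrow> 'a \<Rightarrow> real \<Rightarrow> real) \<Rightarrow> ('a \<Rightarrow> real \<Rightarrow> real) \<Rightarrow> bool" where
  "C21 T \<phi> D1 D2 Dt \<longleftrightarrow>
     continuous_on (UNIV \<times> {0..T}) (\<lambda>(z,t). \<phi> z t) \<and>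
     (\<forall>e\<in>Basis. continuous_on (UNIV \<times> {0..T}) (\<lambda>(z,t). D1 e z t)) \<and>
     (\<forall>e\<in>Basis. \<forall>e'\<in>Basis. continuous_on (UNIV \<times> {0..T}) (\<lambda>(z,t). D2 e e' z t)) \<and>
     continuous_on (UNIV \<times> {0..T}) (\<lambda>(z,t). Dt z t) \<and>
     (\<forall>z. \<forall>t\<in>{0..T}. \<forall>e\<in>Basis.
         ((\<lambda>s. \<phi> (z + s *\<^sub>R e) t) has_real_derivative D1 e z t) (at 0)) \<and>
     (\<forall>z. \<forall>t\<in>{0..T}. \<forall>e\<in>Basis. \<forall>e'\<in>Basis.
         ((\<lambda>s. D1 e (z + s *\<^sub>R e') t) has_real_derivative D2 e e' z t) (at 0)) \<and>
     (\<forall>z. \<forall>t\<in>{0..T}. ((\<lambda>s. \<phi> z s) has_real_derivative Dt z t) (at t within {0..T}))"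

definition compact_supp_on :: "real \<Rightarrow> ('a::euclidean_space \<Rightarrow> real \<Rightarrow> real) \<Rightarrow> bool" where
  "compact_supp_on T \<phi> \<longleftrightarrow> (\<exists>K. compact K \<and> (\<forall>z t. t \<in> {0..T} \<longrightarrow> z \<notin> K \<longrightarrow> \<phi> z t = 0))"

definition grushin_lap ::
  "(((real^'n) \<times> (real^'k)) \<Rightarrow> ((real^'n) \<times> (real^'k)) \<Rightarrow> ((real^'n) \<times> (real^'k)) \<Rightarrow> real \<Rightarrow> real)
     \<Rightarrow> ((real^'n) \<times> (real^'k)) \<Rightarrow> real \<Rightarrow> real" where
  "grushin_lap D2 z t =
     (\<Sum>i\<in>UNIV. D2 (axis i 1, 0) (axis i 1, 0) z t)
     + (norm (fst z))\<^sup>2 * (\<Sum>j\<in>UNIV. D2 (0, axis j 1) (0, axis j 1) z t)"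

definition memory :: "real \<Rightarrow> real \<Rightarrow> ('a \<Rightarrow> real \<Rightarrow> real) \<Rightarrow> 'a \<Rightarrow> real \<Rightarrow> real" where
  "memory \<gamma> p u z t =
     set_lebesgue_integral lborel {0<..<t} (\<lambda>s. (t - s) powr (-\<gamma>) * (\<bar>u z s\<bar> powr (p - 1) * u z s))"

definition weak_solution_on ::
  "real \<Rightarrow> real \<Rightarrow> real \<Rightarrow> (((real^'n) \<times> (real^'k)) \<Rightarrow> real)
     \<Rightarrow> (((real^'n) \<times> (real^'k)) \<Rightarrow> real \<Rightarrow> real) \<Rightarrow> bool" where
  "weak_solution_on T \<gamma> p u0 u \<longleftrightarrow>
     locally_L1 (UNIV \<times> {0<..<T}) (\<lambda>(z,t). u z t) \<and>
     locally_L1 (UNIV \<times> {0<..<T}) (\<lambda>(z,t). memory \<gamma> p u z t) \<and>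
     (\<forall>\<phi> D1 D2 Dt. C21 T \<phi> D1 D2 Dt \<and> compact_supp_on T \<phi> \<and> (\<forall>z. \<phi> z T = 0) \<longrightarrow>
        - (\<integral>z. u0 z * \<phi> z 0 \<partial>lborel) =
          set_lebesgue_integral lborel (UNIV \<times> {0<..<T}) (\<lambda>(z,t). memory \<gamma> p u z t * \<phi> z t)
        + set_lebesgue_integral lborel (UNIV \<times> {0<..<T}) (\<lambda>(z,t). u z t * grushin_lap D2 z t)
        + set_lebesgue_integral lborel (UNIV \<times> {0<..<T}) (\<lambda>(z,t). u z t * Dt z t))"

definition global_weak_solution ::
  "real \<Rightarrow> real \<Rightarrow> (((real^'n) \<times> (real^'k)) \<Rightarrow> real)
     \<Rightarrow> (((real^'n) \<times> (real^'k)) \<Rightarrow> real \<Rightarrow> real) \<Rightarrow> bool" where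
  "global_weak_solution \<gamma> p u0 u \<longleftrightarrow> (\<forall>T>0. weak_solution_on T \<gamma> p u0 u)"

end

(* The test function is g^(k+2) h^(k+1), with g = max(0, 1 - |z|^2/R^2) for a fixed R and
   h = 1 - t/T. On [0,T] the memory kernel is at least T^(-\<gamma>), so the memory term is at least
   T^(-\<gamma>) \<integral>_0^t u^p, and integrating by parts in time gives
     I + c T^(1-\<gamma>) J(T) \<le> C W(T),
   where I = \<integral> u0 g^(k+2), J(T) = \<integral>\<integral> u^p (gh)^(k+2) and W(T) = \<integral>\<integral> u (gh)^k.
   Young's inequality W \<le> \<delta> J + V T \<delta>^(-1/(p-1)) with \<delta> proportional to T^(1-\<gamma>) bounds J(T)
   uniformly in T; this is where p \<gamma> \<le> 1 enters. Hence J(T) converges, and using Young's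
   inequality only for t \<ge> S makes the J-contribution a tail; letting T, then S, then
   \<delta> / T^(1-\<gamma>) tend to infinity gives J = 0, so W = 0 and I \<le> 0. This contradicts u0 \<noteq> 0 once
   the ball of radius R meets the support of u0. *)
theory Submission
  imports Defs
begin

section \<open>Pointwise Young inequality and the real-variable limiting argument\<close>

section \<open>Absorption and the limiting argument\<close>

text \<open>A weighted Young inequality with constant 1, by a dichotomy: either
  \<open>\<delta> * g\<^sup>2 * v powr (p-1)\<close> is at least 1 and the first term on the right
  suffices, or \<open>v\<close> is at most \<open>(\<delta> * g\<^sup>2) powr (-1/(p-1))\<close>. In
  the second case \<open>k\<close> is large enough to cancel the negative power of
  \<open>g\<close>.\<close>

lemma absorb_power:
  fixes v g \<delta> p :: real
  assumes "p > 1" "v \<ge> 0" "\<delta> > 0" "0 \<le> g" "g \<le> 1" "k > 0" "2 / (p - 1) \<le> real k"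
  shows "v * g ^ k \<le> \<delta> * (v powr p * g ^ (k+2)) + \<delta> powr (-1/(p-1))"
proof (cases "g = 0 \<or> v = 0")
  case True
  then show ?thesis using assms by (auto simp: power_0_left)
next
  case False
  then have pos: "g > 0" "v > 0" using assms by auto
  have vp: "v powr p = v powr (p-1) * v"
    using pos powr_add[of v "p-1" 1] by simp
  show ?thesis
  proof (cases "\<delta> * g\<^sup>2 * v powr (p-1) \<ge> 1")
    case True
    have "1 * (v * g^k) \<le> (\<delta> * g\<^sup>2 * v powr (p-1)) * (v * g^k)"
      using True pos by (intro mult_right_mono) auto
    also have "\<dots> = \<delta> * (v powr p * g ^ (k+2))"
      by (simp add: vp power_add power2_eq_square)
    finally show ?thesis by (simp add: add_increasing2)
  next
    case False
    have d: "\<delta> * g\<^sup>2 > 0" using assms pos by simp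
    have "v powr (p-1) \<le> 1 / (\<delta> * g\<^sup>2)" 
      using False d by (simp add: field_simps)
    then have "(v powr (p-1)) powr (1/(p-1)) \<le> (1 / (\<delta> * g\<^sup>2)) powr (1/(p-1))"
      using assms by (intro powr_mono2) auto
    then have "v \<le> (1 / (\<delta> * g\<^sup>2)) powr (1/(p-1))"
      using assms pos by (simp add: powr_powr)
    also have "\<dots> = (\<delta> * g\<^sup>2) powr (-1/(p-1))"
      by (simp add: powr_minus_divide powr_divide)
    also have "\<dots> = \<delta> powr (-1/(p-1)) * g powr (-2/(p-1))"
      using pos by (simp add: powr_mult powr_powr flip: powr_numeral)
    finally have "v * g^k \<le> \<delta> powr (-1/(p-1)) * g powr (-2/(p-1)) * g ^ k"
      using pos by (intro mult_right_mono) auto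
    also have "\<dots> = \<delta> powr (-1/(p-1)) * g powr (real k - 2/(p-1))"
      using pos by (simp add: powr_diff powr_minus_divide powr_realpow)
    also have "\<dots> \<le> \<delta> powr (-1/(p-1)) * 1"
      using pos assms by (intro mult_left_mono powr_le1) auto
    finally show ?thesis using assms pos by (simp add: add_increasing)
  qed
qed

text \<open>With \<delta> = \<kappa> T^(1-\<gamma>), the Young remainder over time T is of order
  T^(1-(1-\<gamma>)/(p-1)). This exponent is at most 1-\<gamma> exactly when p \<gamma> \<le> 1, so
  the remainder does not outgrow the coefficient of J.\<close>

lemma horizon_powr_le:
  fixes T \<kappa> p \<gamma> :: real
  assumes "p > 1" "p * \<gamma> \<le> 1" "T \<ge> 1" "\<kappa> > 0"
  shows "T * (\<kappa> * T powr (1-\<gamma>)) powr (-1/(p-1)) \<le> \<kappa> powr (-1/(p-1)) * T powr (1-\<gamma>)"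
proof -
  have "1 - (1-\<gamma>)/(p-1) \<le> 1 - \<gamma>"
    using assms by (simp add: field_simps)
  then have "T powr (1 - (1-\<gamma>)/(p-1)) \<le> T powr (1-\<gamma>)"
    using assms by (intro powr_mono) auto
  moreover have "T * (\<kappa> * T powr (1-\<gamma>)) powr (-1/(p-1)) = \<kappa> powr (-1/(p-1)) * T powr (1 - (1-\<gamma>)/(p-1))"
  proof -
    have "(\<kappa> * T powr (1-\<gamma>)) powr (-1/(p-1)) = \<kappa> powr (-1/(p-1)) * T powr ((1-\<gamma>) * (-1/(p-1)))"
      using assms by (simp only: powr_mult powr_powr)
    moreover have "T * T powr ((1-\<gamma>) * (-1/(p-1))) = T powr (1 - (1-\<gamma>)/(p-1))"
      using assms powr_add[of T 1 "(1-\<gamma>) * (-1/(p-1))"] by simp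
    ultimately show ?thesis by (simp add: mult_ac)
  qed
  ultimately show ?thesis by (simp add: mult_left_mono)
qed

text \<open>The limiting argument without any PDE. In the application \<open>D S\<close> is the
  integral of u g^k up to time S, \<open>V\<close> is the volume of the ball, and the bracket
  multiplying \<delta> dominates the part of \<open>J T\<close> that comes from times after
  S.\<close>

lemma datum_nonpos:
  fixes J W D :: "real \<Rightarrow> real" and p \<gamma> c C V I :: real
  assumes p: "p > 1" "\<gamma> < 1" "p * \<gamma> \<le> 1" and c: "c > 0" and C: "C > 0" and V: "V \<ge> 0"
    and J0: "J 0 = 0" and D0: "D 0 = 0"
    and mono: "\<And>S T. 0 \<le> S \<Longrightarrow> S \<le> T \<Longrightarrow> J S \<le> J T"
    and energy: "\<And>T. T \<ge> 1 \<Longrightarrow> I + c * T powr (1-\<gamma>) * J T \<le> C * W T"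
    and split: "\<And>S T \<delta>. 0 \<le> S \<Longrightarrow> S \<le> T \<Longrightarrow> 1 \<le> T \<Longrightarrow> \<delta> > 0 \<Longrightarrow>
       W T \<le> D S + \<delta> * (J T - (1 - S/T)^m * J S) + V * (T * \<delta> powr (-1/(p-1)))"
  shows "I \<le> 0"
proof (rule ccontr)
  assume "\<not> I \<le> 0"
  then have I: "I > 0" by simp
  \<comment> \<open>The Young remainder after normalising \<delta> by T^(1-\<gamma>); it tends to 0
    as \<kappa> grows because p > 1.\<close>
  define E where "E = (\<lambda>\<kappa>::real. \<kappa> powr (-1/(p-1)))"
  have E0: "(E \<longlongrightarrow> 0) at_top"
    unfolding E_def using p by (intro tendsto_neg_powr filterlim_ident) auto
  \<comment> \<open>Combine \<open>energy\<close> and \<open>split\<close> for \<delta> = \<kappa>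
    T^(1-\<gamma>), drop I > 0 and divide by T^(1-\<gamma>). Since \<gamma> < 1, the term with
    \<open>D S\<close> then decays in T.\<close>
  have key: "c * J T \<le> C * (D S * T powr (\<gamma>-1) + \<kappa> * (J T - (1 - S/T)^m * J S) + V * E \<kappa>)"
    if "0 \<le> S" "S \<le> T" "1 \<le> T" "\<kappa> > 0" for S T \<kappa>
  proof -
    have T: "T powr (1-\<gamma>) > 0" using that by simp
    have "c * T powr (1-\<gamma>) * J T \<le> C * W T" using energy[of T] I that by simp
    also have "\<dots> \<le> C * (D S + (\<kappa> * T powr (1-\<gamma>)) * (J T - (1 - S/T)^m * J S)
         + V * (T * (\<kappa> * T powr (1-\<gamma>)) powr (-1/(p-1))))"
      using C that T by (intro mult_left_mono split) auto
    also have "\<dots> \<le> C * (D S + (\<kappa> * T powr (1-\<gamma>)) * (J T - (1 - S/T)^m * J S)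
         + V * (E \<kappa> * T powr (1-\<gamma>)))"
      unfolding E_def using C V p that by (intro mult_left_mono add_left_mono horizon_powr_le) auto
    also have "\<dots> = (C * (D S * T powr (\<gamma>-1) + \<kappa> * (J T - (1 - S/T)^m * J S) + V * E \<kappa>)) * T powr (1-\<gamma>)"
    proof -
      have "T powr (\<gamma>-1) * T powr (1-\<gamma>) = 1" using that by (simp flip: powr_add)
      then show ?thesis by (simp add: algebra_simps)
    qed
    finally have "(c * J T) * T powr (1-\<gamma>) \<le> (C * (D S * T powr (\<gamma>-1) + \<kappa> * (J T - (1 - S/T)^m * J S) + V * E \<kappa>)) * T powr (1-\<gamma>)"
      by (simp add: mult_ac)
    then show ?thesis using T by simp
  qed
  \<comment> \<open>For S = 0 and this \<kappa> the J-term on the right is half of the left side,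
    hence absorbed.\<close>
  have bound: "J T \<le> 2 * C * V * E (c / (2*C)) / c" if "T \<ge> 1" for T
    using key[of 0 T "c/(2*C)"] that c C by (simp add: D0 J0 field_simps)
  have Jinc: "incseq (\<lambda>n. J (real n))" by (intro monoI mono) auto
  \<comment> \<open>The maximum with \<open>J 1\<close>, which is nonnegative, covers n = 0, where
    \<open>bound\<close> says nothing.\<close>
  have "J (real n) \<le> max (J 1) (2 * C * V * E (c / (2*C)) / c)" for n
    using bound[of "real n"] mono[of 0 1] J0 by (cases n) auto
  then obtain L where L: "(\<lambda>n. J (real n)) \<longlonglongrightarrow> L" and JL: "\<And>n. J (real n) \<le> L"
    using incseq_convergent[OF Jinc] by metis
  \<comment> \<open>First limit: T to infinity through the integers with S and \<kappa> fixed. The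
    factor (1 - S/T)^m tends to 1, so only the tail \<open>L - J S\<close> survives.\<close>
  have A: "c * L \<le> C * (\<kappa> * (L - J S) + V * E \<kappa>)" if S: "S \<ge> 0" and k: "\<kappa> > 0" for S \<kappa>
  proof (rule tendsto_le[OF sequentially_bot])
    show "(\<lambda>n. c * J (real n)) \<longlonglongrightarrow> c * L" by (intro tendsto_intros L)
    have t1: "(\<lambda>n. real n powr (\<gamma>-1)) \<longlonglongrightarrow> 0"
      using p by (intro tendsto_neg_powr filterlim_real_sequentially) auto
    have t2: "(\<lambda>n. S / real n) \<longlonglongrightarrow> 0"
      by (rule tendsto_divide_0[OF tendsto_const filterlim_at_top_imp_at_infinity[OF filterlim_real_sequentially]])
    have "(\<lambda>n. C * (D S * real n powr (\<gamma>-1) + \<kappa> * (J (real n) - (1 - S/real n)^m * J S) + V * E \<kappa>))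
      \<longlonglongrightarrow> C * (D S * 0 + \<kappa> * (L - (1 - 0)^m * J S) + V * E \<kappa>)"
      by (intro tendsto_intros L t1 t2)
    then show "(\<lambda>n. C * (D S * real n powr (\<gamma>-1) + \<kappa> * (J (real n) - (1 - S/real n)^m * J S) + V * E \<kappa>))
      \<longlonglongrightarrow> C * (\<kappa> * (L - J S) + V * E \<kappa>)" by simp
    show "\<forall>\<^sub>F n in sequentially. c * J (real n) \<le> C * (D S * real n powr (\<gamma>-1) + \<kappa> * (J (real n) - (1 - S/real n)^m * J S) + V * E \<kappa>)"
      using eventually_ge_at_top[of "nat \<lceil>max 1 S\<rceil>"]
      by eventually_elim (rule key, use S k in \<open>auto simp: nat_ceiling_le_eq\<close>)
  qed
  \<comment> \<open>Second limit: S to infinity with \<kappa> fixed, which removes the tail however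
    large \<kappa> is.\<close>
  have B: "c * L \<le> C * (V * E \<kappa>)" if k: "\<kappa> > 0" for \<kappa>
  proof (rule tendsto_le[OF sequentially_bot _ tendsto_const])
    have "(\<lambda>n. C * (\<kappa> * (L - J (real n)) + V * E \<kappa>)) \<longlonglongrightarrow> C * (\<kappa> * (L - L) + V * E \<kappa>)"
      by (intro tendsto_intros L)
    then show "(\<lambda>n. C * (\<kappa> * (L - J (real n)) + V * E \<kappa>)) \<longlonglongrightarrow> C * (V * E \<kappa>)" by simp
    show "\<forall>\<^sub>F n in sequentially. c * L \<le> C * (\<kappa> * (L - J (real n)) + V * E \<kappa>)"
      using k by (intro always_eventually allI A) auto
  qed
  have lim: "((\<lambda>\<kappa>. C * (V * E \<kappa>)) \<longlongrightarrow> C * (V * 0)) at_top" by (intro tendsto_intros E0)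
  have "c * L \<le> C * (V * 0)"
    by (rule tendsto_le[OF _ lim tendsto_const])
       (auto intro: eventually_mono[OF eventually_gt_at_top[of 0]] B)
  then have "L \<le> 0" using c by (simp add: mult_le_0_iff)
  \<comment> \<open>The third limit, in \<kappa>, gave \<open>L \<le> 0\<close>; monotonicity from
    \<open>J 0 = 0\<close> then squeezes \<open>J 1\<close> to zero.\<close>
  then have J1: "J 1 = 0" using JL[of 1] mono[of 0 1] J0 by simp
  \<comment> \<open>The horizon T = 1 is now enough: splitting at S = 0 leaves only
    \<open>V * E \<delta>\<close>, and \<delta> may grow freely.\<close>
  have "I \<le> C * (V * 0)"
  proof (rule tendsto_le[OF _ lim tendsto_const])
    have "I \<le> C * (V * E \<delta>)" if "\<delta> > 0" for \<delta>
    proof -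
      have "I \<le> C * W 1" using energy[of 1] J1 by simp
      also have "\<dots> \<le> C * (V * E \<delta>)"
        using split[of 0 1 \<delta>] that C J1 D0 J0 by (simp add: E_def)
      finally show ?thesis .
    qed
    then show "\<forall>\<^sub>F x in at_top. I \<le> C * (V * E x)"
      by (intro eventually_mono[OF eventually_gt_at_top[of 0]])
  qed simp
  then show False using I by simp
qed

section \<open>A cutoff of class C^(2,1) with explicit derivatives\<close>

section \<open>Test functions\<close>

text \<open>Truncating a quadratic keeps every derivative explicit: for k > 0 its power k+2 is of
  class C^2, and derivatives up to order two still contain the factor g^k.\<close>

definition bump :: "real \<Rightarrow> 'a::real_inner \<Rightarrow> real" where
  "bump R z = max 0 (1 - (z \<bullet> z) / R\<^sup>2)"

lemma bump_nonneg [simp]: "0 \<le> bump R z" and bump_le_1 [simp]: "bump R z \<le> 1"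
  by (auto simp: bump_def)

lemma bump_eq_0:
  assumes "R > 0" "z \<notin> cball 0 R"
  shows "bump R z = 0"
proof -
  have "R\<^sup>2 < z \<bullet> z"
    using assms by (auto simp: dot_square_norm intro!: power_strict_mono)
  then show ?thesis using assms by (simp add: bump_def field_simps)
qed

lemma bump_pos:
  assumes "norm z < R"
  shows "bump R z > 0"
proof -
  have R: "R > 0" using assms norm_ge_zero[of z] by linarith
  have "z \<bullet> z < R\<^sup>2"
    using assms by (auto simp: dot_square_norm intro!: power_strict_mono)
  then show ?thesis using R by (simp add: bump_def)
qed

lemma continuous_on_bump [continuous_intros]:
  "continuous_on A f \<Longrightarrow> continuous_on A (\<lambda>x. bump R (f x))"
  unfolding bump_def by (cases "R = 0") (auto intro!: continuous_intros)

lemma DERIV_max_0_power: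
  assumes "n > 0"
  shows "((\<lambda>x::real. max 0 x ^ Suc n) has_real_derivative (real (Suc n) * max 0 x ^ n)) (at x)"
proof (cases x "0::real" rule: linorder_cases)
  case less
  have "((\<lambda>x::real. 0) has_real_derivative 0) (at x)" by simp
  then have "((\<lambda>x::real. max 0 x ^ Suc n) has_real_derivative 0) (at x)"
    by (rule has_field_derivative_transform_within_open[where S="{..<0}"]) (use less in auto)
  then show ?thesis using less assms by (simp add: max.absorb1 power_0_left del: power_Suc)
next
  case equal
  \<comment> \<open>At the kink, Caratheodory's criterion applies with slope function
    \<open>max 0 z ^ n\<close>, which vanishes at 0 because n > 0.\<close>
  have "((\<lambda>x::real. max 0 x ^ Suc n) has_real_derivative 0) (at 0)"
    unfolding CARAT_DERIV
  proof (intro exI conjI allI)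
    fix z :: real
    show "max 0 z ^ Suc n - max 0 0 ^ Suc n = max 0 z ^ n * (z - 0)"
      using assms by (auto simp: max_def)
    show "isCont (\<lambda>z::real. max 0 z ^ n) 0" by (intro continuous_intros)
  qed (use assms in simp)
  then show ?thesis using equal assms by (simp add: power_0_left del: power_Suc)
next
  case greater
  have "((\<lambda>x::real. x ^ Suc n) has_real_derivative real (Suc n) * x ^ n) (at x)"
    by (rule derivative_eq_intros refl | simp)+
  then have "((\<lambda>x::real. max 0 x ^ Suc n) has_real_derivative real (Suc n) * x ^ n) (at x)"
    by (rule has_field_derivative_transform_within_open[where S="{0<..}"]) (use greater in auto)
  then show ?thesis using greater by (simp add: max_def)
qed

text \<open>On a line, 1 - |z|^2/R^2 is a quadratic polynomial in the parameter, so the one-variable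
  derivative of the truncated power and the chain rule suffice.\<close>

lemma DERIV_bump_power_line:
  assumes "n > 0"
  shows "((\<lambda>s. bump R (z + s *\<^sub>R e) ^ Suc n) has_real_derivative
           real (Suc n) * bump R z ^ n * (- 2 * (z \<bullet> e) / R\<^sup>2)) (at 0)"
proof -
  define c where "c = 1 / R\<^sup>2"
  define q where "q = (\<lambda>s. 1 - (z \<bullet> z + 2 * s * (z \<bullet> e) + s\<^sup>2 * (e \<bullet> e)) * c)"
  have q: "bump R (z + s *\<^sub>R e) = max 0 (q s)" for s
    by (simp add: bump_def q_def c_def inner_add_left inner_add_right inner_commute power2_eq_square algebra_simps add_divide_distrib)
  have "(q has_real_derivative (- 2 * (z \<bullet> e) * c)) (at 0)"
    unfolding q_def by (auto intro!: derivative_eq_intros)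
  then have dq: "(q has_real_derivative (- 2 * (z \<bullet> e) / R\<^sup>2)) (at 0)"
    by (simp add: c_def)
  have "((\<lambda>s. max 0 (q s) ^ Suc n) has_real_derivative
     (real (Suc n) * max 0 (q 0) ^ n) * (- 2 * (z \<bullet> e) / R\<^sup>2)) (at 0)"
    by (rule DERIV_chain2[OF DERIV_max_0_power[OF assms] dq])
  then show ?thesis by (simp only: q[symmetric]) simp
qed

definition bump_D1 :: "real \<Rightarrow> real \<Rightarrow> nat \<Rightarrow> 'a::real_inner \<Rightarrow> 'a \<Rightarrow> real \<Rightarrow> real" where
  "bump_D1 R T k e z t =
     - (2 * real (k+2) / R\<^sup>2) * bump R z ^ (k+1) * (z \<bullet> e) * (1 - t/T) ^ (k+1)"

text \<open>The Hessian of g^(k+2) h^(k+1) as a bilinear form. Its lowest power of g is g^k, the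
  power that occurs in W.\<close>

definition bump_D2 :: "real \<Rightarrow> real \<Rightarrow> nat \<Rightarrow> 'a::real_inner \<Rightarrow> 'a \<Rightarrow> 'a \<Rightarrow> real \<Rightarrow> real" where
  "bump_D2 R T k e e' z t =
     (4 * real (k+2) * real (k+1) / R^4 * bump R z ^ k * (z \<bullet> e) * (z \<bullet> e')
       - 2 * real (k+2) / R\<^sup>2 * bump R z ^ (k+1) * (e \<bullet> e')) * (1 - t/T) ^ (k+1)"

text \<open>The exponents k+2 and k+1 differ because second space derivatives cost two powers of g
  and the time derivative one power of h; both leave at least (gh)^k.\<close>

lemma C21_bump:
  fixes R T :: real
  assumes "R > 0" "T > 0" "k > 0"
  shows "C21 T (\<lambda>z t. bump R (z::'a::euclidean_space) ^ (k+2) * (1 - t/T) ^ (k+1))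
           (bump_D1 R T k) (bump_D2 R T k)
           (\<lambda>z t. - (real (k+1) / T) * (bump R z ^ (k+2) * (1 - t/T) ^ k))"
  unfolding C21_def
proof (intro conjI ballI allI)
  fix z e e' :: 'a and t :: real
  show "((\<lambda>s. bump R (z + s *\<^sub>R e) ^ (k+2) * (1 - t/T) ^ (k+1)) has_real_derivative bump_D1 R T k e z t) (at 0)"
    using DERIV_cmult_right[OF DERIV_bump_power_line[of "k+1" R z e], of "(1 - t/T) ^ (k+1)"]
    by (simp add: bump_D1_def mult_ac)
  have lin: "((\<lambda>s. a * ((z + s *\<^sub>R e') \<bullet> e) * b) has_real_derivative a * (e' \<bullet> e) * b) (at 0)"
    for a b
    by (auto intro!: derivative_eq_intros simp: inner_add_left)
  show "((\<lambda>s. bump_D1 R T k e (z + s *\<^sub>R e') t) has_real_derivative bump_D2 R T k e e' z t) (at 0)"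
  proof -
    let ?a = "- (2 * real (k+2) / R\<^sup>2)" and ?b = "(1 - t/T) ^ (k+1)"
    \<comment> \<open>Written as g^(k+1) times a factor affine in s, the first derivative is again
      accessible to the line derivative and the product rule.\<close>
    have D1: "bump_D1 R T k e (z + s *\<^sub>R e') t
        = bump R (z + s *\<^sub>R e') ^ Suc k * (?a * ((z + s *\<^sub>R e') \<bullet> e) * ?b)" for s
      by (simp add: bump_D1_def mult_ac)
    have "bump_D2 R T k e e' z t = real (Suc k) * bump R z ^ k * (- 2 * (z \<bullet> e') / R\<^sup>2)
          * (?a * (z \<bullet> e) * ?b) + ?a * (e' \<bullet> e) * ?b * bump R z ^ Suc k"
      using assms by (simp add: bump_D2_def inner_commute field_simps eval_nat_numeral)
    then show ?thesis
      unfolding D1 using DERIV_mult[OF DERIV_bump_power_line[of k R z e', OF assms(3)] lin[of ?a ?b]] by simp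
  qed
  show "((\<lambda>s. bump R z ^ (k+2) * (1 - s/T) ^ (k+1)) has_real_derivative
      - (real (k+1) / T) * (bump R z ^ (k+2) * (1 - t/T) ^ k)) (at t within {0..T})"
  proof -
    have "((\<lambda>s. 1 - s/T) has_real_derivative - (1/T)) (at t within {0..T})"
      using assms by (auto intro!: derivative_eq_intros)
    from DERIV_cmult[OF DERIV_power_Suc[OF this, of k], of "bump R z ^ (k+2)"]
    show ?thesis by (simp add: mult_ac)
  qed
qed (use assms in \<open>auto simp: bump_D1_def bump_D2_def case_prod_unfold intro!: continuous_intros\<close>)

text \<open>Inside the ball, |z . e| \<le> R turns R^(-4) into R^(-2), and g \<le> 1 lowers g^(k+1)
  to g^k. Outside the ball both sides vanish because k > 0.\<close>

lemma abs_bump_D2_le: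
  assumes "R > 0" "k > 0" "norm e = 1"
  shows "\<bar>bump_D2 R T k e e z t\<bar>
     \<le> (4 * real (k+2) * real (k+1) + 2 * real (k+2)) / R\<^sup>2 * (bump R z ^ k * \<bar>1 - t/T\<bar> ^ (k+1))"
proof (cases "z \<in> cball 0 R")
  case True
  have "\<bar>z \<bullet> e\<bar> \<le> R" using Cauchy_Schwarz_ineq2[of z e] True assms by simp
  then have "(z \<bullet> e)\<^sup>2 \<le> R\<^sup>2" by (metis abs_ge_zero power_mono power2_abs)
  then have "4 * real (k+2) * real (k+1) / R^4 * bump R z ^ k * (z \<bullet> e)\<^sup>2
     \<le> 4 * real (k+2) * real (k+1) / R^4 * bump R z ^ k * R\<^sup>2"
    using assms by (intro mult_left_mono) auto
  also have "\<dots> = 4 * real (k+2) * real (k+1) / R\<^sup>2 * bump R z ^ k"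
    using assms by (simp add: field_simps eval_nat_numeral)
  finally have 1: "4 * real (k+2) * real (k+1) / R^4 * bump R z ^ k * (z \<bullet> e)\<^sup>2
     \<le> 4 * real (k+2) * real (k+1) / R\<^sup>2 * bump R z ^ k" .
  have "bump R z ^ (k+1) \<le> bump R z ^ k" by (rule power_decreasing) auto
  then have 2: "2 * real (k+2) / R\<^sup>2 * bump R z ^ (k+1) \<le> 2 * real (k+2) / R\<^sup>2 * bump R z ^ k"
    by (intro mult_left_mono) auto
  have e: "e \<bullet> e = 1" using assms by (simp add: dot_square_norm)
  have "\<bar>4 * real (k+2) * real (k+1) / R^4 * bump R z ^ k * (z \<bullet> e)\<^sup>2
       - 2 * real (k+2) / R\<^sup>2 * bump R z ^ (k+1)\<bar>
     \<le> \<bar>4 * real (k+2) * real (k+1) / R^4 * bump R z ^ k * (z \<bullet> e)\<^sup>2\<bar> +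
        \<bar>2 * real (k+2) / R\<^sup>2 * bump R z ^ (k+1)\<bar>" by (rule abs_triangle_ineq4)
  also have "\<dots> \<le> (4 * real (k+2) * real (k+1) + 2 * real (k+2)) / R\<^sup>2 * bump R z ^ k"
    using 1 2 unfolding add_divide_distrib distrib_right[of _ _ "bump R z ^ k"]
    by (intro add_mono) (simp_all add: abs_of_nonneg del: of_nat_add of_nat_Suc)
  finally show ?thesis
    by (simp only: bump_D2_def e abs_mult power_abs power2_eq_square mult.assoc mult_1_right)
       (simp only: mult_right_mono mult.assoc[symmetric] zero_le_power abs_ge_zero)
next
  case False
  then show ?thesis using bump_eq_0[OF assms(1) False] assms
    by (simp add: bump_D2_def power_0_left)
qed

text \<open>On the support of the cutoff the degenerate weight |x|^2 is at most R^2. Since R is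
  fixed and only T varies, this crude bound replaces any anisotropic scaling of x and y.\<close>

lemma grushin_lap_bump_le:
  fixes z :: "(real^'n) \<times> (real^'k)"
  assumes "R > 0" "k > 0"
  shows "\<bar>grushin_lap (bump_D2 R T k) z t\<bar>
     \<le> (real CARD('n) + R\<^sup>2 * real CARD('k)) * ((4 * real (k+2) * real (k+1) + 2 * real (k+2)) / R\<^sup>2)
        * (bump R z ^ k * \<bar>1 - t/T\<bar> ^ (k+1))"
    (is "_ \<le> _ * ?B * ?h")
proof (cases "z \<in> cball 0 R")
  case True
  have D2: "\<bar>bump_D2 R T k e e z t\<bar> \<le> ?B * ?h" if "norm e = 1" for e
    using abs_bump_D2_le[OF assms that] by simp
  have x: "\<bar>\<Sum>i\<in>UNIV. bump_D2 R T k (axis i 1, 0) (axis i 1, 0) z t\<bar> \<le> real CARD('n) * (?B * ?h)"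
    by (rule order.trans[OF sum_abs sum_bounded_above]) (intro D2, simp)
  have y: "\<bar>\<Sum>i\<in>UNIV. bump_D2 R T k (0, axis i 1) (0, axis i 1) z t\<bar> \<le> real CARD('k) * (?B * ?h)"
    by (rule order.trans[OF sum_abs sum_bounded_above]) (intro D2, simp)
  have "(norm (fst z))\<^sup>2 \<le> R\<^sup>2"
    using True order.trans[OF norm_fst_le, of "fst z" "snd z" R] by (intro power_mono) auto
  then have "\<bar>(norm (fst z))\<^sup>2 * (\<Sum>i\<in>UNIV. bump_D2 R T k (0, axis i 1) (0, axis i 1) z t)\<bar>
     \<le> R\<^sup>2 * (real CARD('k) * (?B * ?h))"
    unfolding abs_mult using y by (intro mult_mono) auto
  with x have "\<bar>grushin_lap (bump_D2 R T k) z t\<bar> \<le> real CARD('n) * (?B * ?h) + R\<^sup>2 * (real CARD('k) * (?B * ?h))"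
    unfolding grushin_lap_def by (intro order.trans[OF abs_triangle_ineq add_mono]) auto
  then show ?thesis by (simp only: distrib_right mult.assoc)
next
  case False
  then show ?thesis
    using bump_eq_0[OF assms(1) False] assms(2)
    by (simp add: grushin_lap_def bump_D2_def power_0_left)
qed

section \<open>Bounds, measurability and time averages of the memory term\<close>

section \<open>The memory term\<close>

text \<open>The primitive -(t-s)^(1-\<gamma>)/(1-\<gamma>) is continuous up to s = t although the
  kernel may blow up there, so the fundamental theorem is used with differentiability in the
  interior only. Nonnegativity upgrades this to Lebesgue integrability.\<close>

lemma
  fixes t \<gamma> :: real
  assumes "0 \<le> \<gamma>" "\<gamma> < 1" "0 \<le> t"
  shows set_integrable_kernel: "set_integrable lborel {0<..<t} (\<lambda>s. (t - s) powr (-\<gamma>))"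
    and set_integral_kernel: "(LINT s:{0<..<t}|lborel. (t - s) powr (-\<gamma>)) = t powr (1-\<gamma>) / (1-\<gamma>)"
proof -
  have "((\<lambda>s. (t - s) powr (-\<gamma>)) has_integral
      (- ((t - t) powr (1-\<gamma>) / (1-\<gamma>)) - - ((t - 0) powr (1-\<gamma>) / (1-\<gamma>)))) {0..t}"
  proof (rule fundamental_theorem_of_calculus_interior)
    show "continuous_on {0..t} (\<lambda>s. - ((t - s) powr (1-\<gamma>) / (1-\<gamma>)))"
      using assms by (auto intro!: continuous_intros continuous_on_powr')
    fix x assume x: "x \<in> {0<..<t}"
    show "((\<lambda>s. - ((t - s) powr (1-\<gamma>) / (1-\<gamma>))) has_vector_derivative (t - x) powr (-\<gamma>)) (at x)"
      unfolding has_real_derivative_iff_has_vector_derivative[symmetric]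
      using x assms by (auto intro!: derivative_eq_intros)
  qed (use assms in auto)
  then have hi: "((\<lambda>s. (t - s) powr (-\<gamma>)) has_integral t powr (1-\<gamma>) / (1-\<gamma>)) {0<..<t}"
    using assms by (simp add: has_integral_Icc_iff_Ioo)
  then have "(\<lambda>s. (t - s) powr (-\<gamma>)) absolutely_integrable_on {0<..<t}"
    by (intro nonnegative_absolutely_integrable_1) (auto simp: integrable_on_def)
  then show si: "set_integrable lborel {0<..<t} (\<lambda>s. (t - s) powr (-\<gamma>))"
    unfolding set_integrable_def by (subst (asm) integrable_completion) auto
  show "(LINT s:{0<..<t}|lborel. (t - s) powr (-\<gamma>)) = t powr (1-\<gamma>) / (1-\<gamma>)"
    using set_borel_integral_eq_integral(2)[OF si] integral_unique[OF hi] by simp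
qed

lemma set_integrable_continuous_Ioo:
  fixes f :: "real \<Rightarrow> real"
  assumes "continuous_on {a..b} f"
  shows "set_integrable lborel {a<..<b} f"
  by (rule set_integrable_subset[of _ "{a..b}"])
     (use borel_integrable_compact[OF compact_Icc assms] in \<open>auto simp: set_integrable_def\<close>)

lemma powr_diff_1_mult_self:
  fixes v :: real
  assumes "v \<ge> 0"
  shows "v powr (p-1) * v = v powr p"
proof (cases "v = 0")
  case False
  then show ?thesis using assms powr_add[of v "p-1" 1, symmetric] by simp
qed simp

text \<open>The lower bound replaces the kernel by its least possible value T^(-\<gamma>) and drives
  the nonexistence argument; the upper bound serves as an integrable majorant later.\<close>

lemma memory_bounds:
  fixes u :: "'a \<Rightarrow> real \<Rightarrow> real"
  assumes g: "0 \<le> \<gamma>" "\<gamma> < 1" and p: "p > 1" and t: "0 < t" "t \<le> T"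
    and cont: "continuous_on {0..T} (u z)" and nn: "\<And>s. 0 \<le> s \<Longrightarrow> u z s \<ge> 0"
    and M: "\<And>s. s \<in> {0..T} \<Longrightarrow> u z s powr p \<le> M"
  shows memory_ge: "T powr (-\<gamma>) * (LINT s:{0<..<t}|lborel. u z s powr p) \<le> memory \<gamma> p u z t"
    and memory_nonneg: "0 \<le> memory \<gamma> p u z t"
    and memory_le: "memory \<gamma> p u z t \<le> M * (T powr (1-\<gamma>) / (1-\<gamma>))"
proof -
  have eq: "memory \<gamma> p u z t = (LINT s:{0<..<t}|lborel. (t - s) powr (-\<gamma>) * u z s powr p)"
    unfolding memory_def
  proof (rule set_lebesgue_integral_cong, simp, intro allI impI)
    fix s assume "s \<in> {0<..<t}"
    then have "0 \<le> s" by simp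
    from nn[OF this] have "\<bar>u z s\<bar> powr (p - 1) * u z s = u z s powr p"
      using powr_diff_1_mult_self[of "u z s" p] by (metis abs_of_nonneg)
    then show "(t - s) powr (-\<gamma>) * (\<bar>u z s\<bar> powr (p - 1) * u z s) = (t - s) powr (-\<gamma>) * u z s powr p"
      by (rule arg_cong)
  qed
  have contp: "continuous_on {0..t} (\<lambda>s. u z s powr p)"
  proof (rule continuous_on_powr'[OF _ continuous_on_const])
    show "continuous_on {0..t} (u z)" by (rule continuous_on_subset[OF cont]) (use t in auto)
  qed (use nn p in auto)
  have M0: "M \<ge> 0" by (rule order.trans[OF powr_ge_zero M[of 0]]) (use t in auto)
  have kerM: "set_integrable lborel {0<..<t} (\<lambda>s. M * (t - s) powr (-\<gamma>))"
    using set_integrable_kernel[OF g, of t] t by simp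
  have meas: "set_borel_measurable lborel {0<..<t} (\<lambda>s. (t - s) powr (-\<gamma>) * u z s powr p)"
  proof -
    have "(\<lambda>s. indicator {0<..<t} s *\<^sub>R u z s powr p) \<in> borel_measurable borel"
      by (rule borel_measurable_continuous_on_indicator) (auto intro: continuous_on_subset[OF contp])
    then have "(\<lambda>s. (t - s) powr (-\<gamma>) * (indicator {0<..<t} s *\<^sub>R u z s powr p)) \<in> borel_measurable borel"
      by measurable
    then show ?thesis by (simp add: set_borel_measurable_def mult_ac)
  qed
  have le: "(t - s) powr (-\<gamma>) * u z s powr p \<le> M * (t - s) powr (-\<gamma>)" if "s \<in> {0<..<t}" for s
    unfolding mult.commute[of _ "u z s powr p"] by (intro mult_right_mono M) (use that t in auto)
  have int: "set_integrable lborel {0<..<t} (\<lambda>s. (t - s) powr (-\<gamma>) * u z s powr p)"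
  proof (rule set_integrable_bound[OF kerM meas], rule AE_I2, rule impI)
    fix s assume "s \<in> {0<..<t}"
    from le[OF this] show "norm ((t - s) powr (-\<gamma>) * u z s powr p) \<le> norm (M * (t - s) powr (-\<gamma>))"
      using M0 by (simp add: abs_mult)
  qed
  have "T powr (-\<gamma>) * (LINT s:{0<..<t}|lborel. u z s powr p)
     = (LINT s:{0<..<t}|lborel. T powr (-\<gamma>) * u z s powr p)" by simp
  also have "\<dots> \<le> memory \<gamma> p u z t"
    unfolding eq
  proof (rule set_integral_mono[OF _ int])
    show "set_integrable lborel {0<..<t} (\<lambda>s. T powr (-\<gamma>) * u z s powr p)"
      using set_integrable_continuous_Ioo[OF contp] by simp
    fix s assume s: "s \<in> {0<..<t}"
    have "T powr (-\<gamma>) \<le> (t - s) powr (-\<gamma>)"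
      using s t g by (intro powr_mono2') auto
    then show "T powr (-\<gamma>) * u z s powr p \<le> (t - s) powr (-\<gamma>) * u z s powr p"
      by (intro mult_right_mono) auto
  qed
  finally show ge: "T powr (-\<gamma>) * (LINT s:{0<..<t}|lborel. u z s powr p) \<le> memory \<gamma> p u z t" .
  have "0 \<le> (LINT s:{0<..<t}|lborel. u z s powr p)"
    unfolding set_lebesgue_integral_def by (intro integral_nonneg_AE) auto
  then show "0 \<le> memory \<gamma> p u z t" using ge by (meson mult_nonneg_nonneg order.trans powr_ge_zero)
  have "memory \<gamma> p u z t \<le> (LINT s:{0<..<t}|lborel. M * (t - s) powr (-\<gamma>))"
    unfolding eq
    by (rule set_integral_mono[OF int kerM le])
  also have "\<dots> = M * (t powr (1-\<gamma>) / (1-\<gamma>))"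
    using set_integral_kernel[OF g, of t] t by simp
  also have "\<dots> \<le> M * (T powr (1-\<gamma>) / (1-\<gamma>))"
    using M0 t g by (intro mult_left_mono divide_right_mono powr_mono2) auto
  finally show "memory \<gamma> p u z t \<le> M * (T powr (1-\<gamma>) / (1-\<gamma>))" .
qed

text \<open>Integration by parts in time: h^n is -T/(n+1) times the derivative of h^(n+1). The
  resulting factor T is what improves T^(-\<gamma>) to T^(1-\<gamma>).\<close>

lemma integral_primitive_times_weight:
  fixes f :: "real \<Rightarrow> real"
  assumes T: "T > 0" and f: "continuous_on {0..T} f"
  shows "set_integrable lborel {0<..<T} (\<lambda>t. (LINT s:{0<..<t}|lborel. f s) * (1 - t/T) ^ n)" (is ?A)
    and "(LINT t:{0<..<T}|lborel. (LINT s:{0<..<t}|lborel. f s) * (1 - t/T) ^ n)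
      = T / real (n+1) * (LINT t:{0<..<T}|lborel. f t * (1 - t/T) ^ (n+1))" (is ?B)
proof -
  define G where "G = (\<lambda>t. integral {0..t} f)"
  have dG: "(G has_real_derivative f t) (at t within {0..T})" if "t \<in> {0..T}" for t
    unfolding G_def using f that by (rule integral_has_real_derivative)
  then have cG: "continuous_on {0..T} G"
    by (rule DERIV_continuous_on)
  have G: "(LINT s:{0<..<t}|lborel. f s) = G t" if "t \<in> {0<..<T}" for t
  proof -
    have "set_integrable lborel {0<..<t} f"
      by (intro set_integrable_continuous_Ioo continuous_on_subset[OF f]) (use that in auto)
    then show ?thesis
      using set_borel_integral_eq_integral(2) by (fastforce simp: G_def integral_open_interval_real)
  qed
  have c1: "continuous_on {0..T} (\<lambda>t. G t * (1 - t/T) ^ n)"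
    and c2: "continuous_on {0..T} (\<lambda>t. f t * (1 - t/T) ^ (n+1))"
    using T by (auto intro!: continuous_intros cG f)
  have eq: "set_integrable lborel {0<..<T} (\<lambda>t. (LINT s:{0<..<t}|lborel. f s) * (1 - t/T) ^ n)
     \<longleftrightarrow> set_integrable lborel {0<..<T} (\<lambda>t. G t * (1 - t/T) ^ n)"
    by (rule set_integrable_cong) (auto simp: G)
  then show ?A using set_integrable_continuous_Ioo[OF c1] by simp
  \<comment> \<open>The boundary terms of the product vanish: h is zero at T and the primitive is
    zero at 0.\<close>
  have "((\<lambda>t. f t * (1 - t/T) ^ (n+1) - real (n+1) / T * (G t * (1 - t/T) ^ n)) has_integral
      (G T * (1 - T/T)^(n+1) - G 0 * (1 - 0/T) ^ (n+1))) {0..T}"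
  proof (rule fundamental_theorem_of_calculus)
    fix t assume t: "t \<in> {0..T}"
    have h: "((\<lambda>s. 1 - s/T) has_real_derivative - (1/T)) (at t within {0..T})"
      using T by (auto intro!: derivative_eq_intros)
    show "((\<lambda>t. G t * (1 - t/T) ^ (n+1)) has_vector_derivative
       f t * (1 - t/T) ^ (n+1) - real (n+1) / T * (G t * (1 - t/T) ^ n)) (at t within {0..T})"
      unfolding has_real_derivative_iff_has_vector_derivative[symmetric]
      using DERIV_mult[OF dG[OF t] DERIV_power_Suc[OF h, of n]] 
      by (simp add: algebra_simps)
  qed (use T in auto)
  then have 0: "((\<lambda>t. f t * (1 - t/T) ^ (n+1) - real (n+1) / T * (G t * (1 - t/T) ^ n)) has_integral 0) {0..T}"
    using T by (simp add: G_def)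
  have "integral {0..T} (\<lambda>t. f t * (1 - t/T) ^ (n+1)) - real (n+1) / T * integral {0..T} (\<lambda>t. G t * (1 - t/T) ^ n) = 0"
    using has_integral_unique[OF 0 has_integral_diff[OF integrable_integral[OF integrable_continuous_real[OF c2]]
        has_integral_mult_right[OF integrable_integral[OF integrable_continuous_real[OF c1]], of "real (n+1) / T"]]]
    by simp
  then have "integral {0..T} (\<lambda>t. G t * (1 - t/T) ^ n) = T / real (n+1) * integral {0..T} (\<lambda>t. f t * (1 - t/T) ^ (n+1))"
    using T by (simp add: divide_simps mult_ac del: of_nat_add)
  moreover have "(LINT t:{0<..<T}|lborel. (LINT s:{0<..<t}|lborel. f s) * (1 - t/T) ^ n)
      = (LINT t:{0<..<T}|lborel. G t * (1 - t/T) ^ n)"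
    by (rule set_lebesgue_integral_cong) (auto simp: G)
  ultimately show ?B
    using set_borel_integral_eq_integral(2)[OF set_integrable_continuous_Ioo[OF c1]]
      set_borel_integral_eq_integral(2)[OF set_integrable_continuous_Ioo[OF c2]]
    by (simp add: integral_open_interval_real)
qed

text \<open>The memory term is a parameter integral of a jointly Borel integrand, hence jointly
  Borel in (z,t).\<close>

lemma borel_measurable_memory:
  fixes u :: "'a::euclidean_space \<Rightarrow> real \<Rightarrow> real"
  assumes "continuous_on (UNIV \<times> {0..}) (\<lambda>(z,t). u z t)"
  shows "(\<lambda>(z,t). memory \<gamma> p u z t) \<in> borel_measurable borel"
proof -
  \<comment> \<open>Extension of u by zero to negative times, where nothing is assumed about u; the
    integral only sees times in (0,t).\<close>
  define v where "v = (\<lambda>x. indicator (UNIV \<times> {0..}) x *\<^sub>R (case x of (z,t) \<Rightarrow> u z t))"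
  have v[measurable]: "v \<in> borel_measurable borel"
    unfolding v_def using assms by (intro borel_measurable_continuous_on_indicator borel_closed closed_Times) auto
  have "(\<lambda>x. \<integral>s. (if 0 < s \<and> s < snd x then
        (snd x - s) powr (-\<gamma>) * (\<bar>v (fst x, s)\<bar> powr (p - 1) * v (fst x, s)) else 0) \<partial>lborel)
      \<in> borel_measurable (borel \<Otimes>\<^sub>M borel)"
    by measurable
  also have "(\<lambda>x. \<integral>s. (if 0 < s \<and> s < snd x then
        (snd x - s) powr (-\<gamma>) * (\<bar>v (fst x, s)\<bar> powr (p - 1) * v (fst x, s)) else 0) \<partial>lborel)
     = (\<lambda>(z,t). memory \<gamma> p u z t)"
    unfolding memory_def set_lebesgue_integral_def
    by (auto simp: fun_eq_iff v_def indicator_def intro!: Bochner_Integration.integral_cong)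
  finally show ?thesis by (simp add: borel_prod)
qed

lemma continuous_on_slice:
  assumes "continuous_on (UNIV \<times> {0..}) (\<lambda>(z,t). u z (t::real))"
  shows "continuous_on {0..T} (u z)"
proof -
  have "continuous_on {0..T} (Pair z)" "Pair z ` {0..T} \<subseteq> UNIV \<times> {0..}"
    by (intro continuous_on_Pair continuous_on_const continuous_on_id) auto
  from continuous_on_compose2[OF assms this] show ?thesis by simp
qed

text \<open>At fixed z, insert the kernel bound T^(-\<gamma>) and integrate by parts in time;
  T^(-\<gamma>) times the factor T/(n+1) gives the constant.\<close>

lemma weighted_memory_ge:
  fixes u :: "'a::euclidean_space \<Rightarrow> real \<Rightarrow> real"
  assumes g: "0 \<le> \<gamma>" "\<gamma> < 1" and p: "p > 1" and T: "T > 0"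
    and cont: "continuous_on (UNIV \<times> {0..}) (\<lambda>(z,t). u z t)" and nn: "\<And>s. 0 \<le> s \<Longrightarrow> u z s \<ge> 0"
  shows "T powr (1-\<gamma>) / real (n+1) * (LINT t:{0<..<T}|lborel. u z t powr p * (1 - t/T) ^ (n+1))
     \<le> (LINT t:{0<..<T}|lborel. memory \<gamma> p u z t * (1 - t/T) ^ n)"
proof -
  note cz = continuous_on_slice[OF cont]
  have cp: "continuous_on {0..T} (\<lambda>s. u z s powr p)"
    by (rule continuous_on_powr'[OF cz continuous_on_const]) (use nn p in auto)
  obtain M where M: "\<And>s. s \<in> {0..T} \<Longrightarrow> u z s powr p \<le> M"
    using compact_continuous_image[OF cp compact_Icc, THEN compact_imp_bounded]
    unfolding bounded_iff by fastforce
  have [measurable]: "(\<lambda>t. memory \<gamma> p u z t) \<in> borel_measurable borel"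
  proof -
    have "Pair z \<in> borel_measurable (borel :: real measure)"
      by (intro borel_measurable_continuous_onI continuous_on_Pair continuous_on_const continuous_on_id)
    from measurable_compose[OF this borel_measurable_memory[OF cont]] show ?thesis by simp
  qed
  have bnd: "0 \<le> memory \<gamma> p u z t" "memory \<gamma> p u z t \<le> M * (T powr (1-\<gamma>) / (1-\<gamma>))"
    "T powr (-\<gamma>) * (LINT s:{0<..<t}|lborel. u z s powr p) \<le> memory \<gamma> p u z t" if "t \<in> {0<..<T}" for t
  proof -
    have t: "0 < t" "t \<le> T" using that by auto
    note mb = memory_bounds[where u=u and z=z, OF g p t cz nn M]
    show "0 \<le> memory \<gamma> p u z t" "memory \<gamma> p u z t \<le> M * (T powr (1-\<gamma>) / (1-\<gamma>))"
      "T powr (-\<gamma>) * (LINT s:{0<..<t}|lborel. u z s powr p) \<le> memory \<gamma> p u z t"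
      by (rule mb; assumption)+
  qed
  have int: "set_integrable lborel {0<..<T} (\<lambda>t. memory \<gamma> p u z t * (1 - t/T) ^ n)"
  proof (rule set_integrable_bound)
    show "set_integrable lborel {0<..<T} (\<lambda>t. M * (T powr (1-\<gamma>) / (1-\<gamma>)))"
      by (intro set_integrable_continuous_Ioo continuous_intros)
    show "set_borel_measurable lborel {0<..<T} (\<lambda>t. memory \<gamma> p u z t * (1 - t/T) ^ n)"
      unfolding set_borel_measurable_def by measurable
    have "\<bar>memory \<gamma> p u z t * (1 - t/T) ^ n\<bar> \<le> \<bar>M * (T powr (1-\<gamma>) / (1-\<gamma>))\<bar>" if t: "t \<in> {0<..<T}" for t
    proof -
      have "(1 - t/T) ^ n \<le> 1" using t by (intro power_le_one) auto
      then have "memory \<gamma> p u z t * (1 - t/T) ^ n \<le> memory \<gamma> p u z t"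
        using bnd[OF t] mult_left_le by blast
      moreover have "0 \<le> memory \<gamma> p u z t * (1 - t/T) ^ n" using bnd[OF t] t by simp
      ultimately show ?thesis using bnd[OF t] by linarith
    qed
    then show "AE t in lborel. t \<in> {0<..<T} \<longrightarrow> norm (memory \<gamma> p u z t * (1 - t/T) ^ n) \<le> norm (M * (T powr (1-\<gamma>) / (1-\<gamma>)))"
      by auto
  qed
  have "T powr (1-\<gamma>) / real (n+1) * (LINT t:{0<..<T}|lborel. u z t powr p * (1 - t/T) ^ (n+1))
    = T powr (-\<gamma>) * (LINT t:{0<..<T}|lborel. (LINT s:{0<..<t}|lborel. u z s powr p) * (1 - t/T) ^ n)"
    unfolding integral_primitive_times_weight(2)[OF T cp]
    using T powr_add[of T 1 "-\<gamma>"] by simp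
  also have "\<dots> = (LINT t:{0<..<T}|lborel. T powr (-\<gamma>) * ((LINT s:{0<..<t}|lborel. u z s powr p) * (1 - t/T) ^ n))"
    by simp
  also have "\<dots> \<le> (LINT t:{0<..<T}|lborel. memory \<gamma> p u z t * (1 - t/T) ^ n)"
  proof (rule set_integral_mono[OF set_integrable_mult_right int])
    fix t assume t: "t \<in> {0<..<T}"
    show "T powr (-\<gamma>) * ((LINT s:{0<..<t}|lborel. u z s powr p) * (1 - t/T) ^ n) \<le> memory \<gamma> p u z t * (1 - t/T) ^ n"
      unfolding mult.assoc[symmetric] using t by (intro mult_right_mono bnd) auto
  qed (rule integral_primitive_times_weight(1)[OF T cp])
  finally show ?thesis .
qed

section \<open>Joint continuity, Fubini and integrability on cylinders\<close>

section \<open>Integrals over space-time cylinders\<close>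

text \<open>The modulus of continuity in time is uniform in space, so it may be used at the moving
  point z' before comparing z' with z at the fixed time t.\<close>

lemma C0_path_continuous_on:
  assumes "C0_path u"
  shows "continuous_on (UNIV \<times> {0..}) (\<lambda>(z,t). u z t)"
  unfolding continuous_on_iff
proof (intro ballI allI impI)
  fix x :: "'a \<times> real" and e :: real
  assume x: "x \<in> UNIV \<times> {0..}" and e: "e > 0"
  obtain z t where zt: "x = (z, t)" by (cases x)
  then have t: "t \<ge> 0" using x by simp
  have e3: "e/3 > 0" using e by simp
  have "\<forall>t\<ge>0. \<forall>e>0. \<exists>d>0. \<forall>s\<ge>0. \<bar>s - t\<bar> < d \<longrightarrow> (\<forall>z. \<bar>u z s - u z t\<bar> \<le> e)"
    using assms unfolding C0_path_def by (rule conjunct2)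
  from this[rule_format, OF t e3] obtain d1
    where d1: "d1 > 0" "\<And>s z. s \<ge> 0 \<Longrightarrow> \<bar>s - t\<bar> < d1 \<Longrightarrow> \<bar>u z s - u z t\<bar> \<le> e/3"
    by auto
  have "continuous_on UNIV (\<lambda>z. u z t)" using assms t by (simp add: C0_path_def C0_def)
  then obtain d2 where d2: "d2 > 0" "\<And>z'. dist z' z < d2 \<Longrightarrow> dist (u z' t) (u z t) < e/3"
    unfolding continuous_on_iff using e3 by (metis UNIV_I)
  show "\<exists>d>0. \<forall>x'\<in>UNIV \<times> {0..}. dist x' x < d \<longrightarrow>
      dist (case x' of (z, t) \<Rightarrow> u z t) (case x of (z, t) \<Rightarrow> u z t) < e"
  proof (intro exI conjI ballI impI)
    show "min d1 d2 > 0" using d1 d2 by simp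
    fix x' :: "'a \<times> real"
    assume x': "x' \<in> UNIV \<times> {0..}" and d: "dist x' x < min d1 d2"
    obtain z' s where zs: "x' = (z', s)" by (cases x')
    have "dist z' z < d2" "dist s t < d1"
      using d dist_fst_le[of x' x] dist_snd_le[of x' x] by (auto simp: zs zt)
    then have "\<bar>u z' s - u z' t\<bar> \<le> e/3" "dist (u z' t) (u z t) < e/3"
      using d1(2)[of s z'] d2(2)[of z'] x' by (auto simp: zs dist_real_def)
    then show "dist (case x' of (z, t) \<Rightarrow> u z t) (case x of (z, t) \<Rightarrow> u z t) < e"
      using e unfolding zs zt prod.case dist_real_def by linarith
  qed
qed

abbreviation cyl :: "real \<Rightarrow> real \<Rightarrow> ('a::euclidean_space \<times> real) set" where
  "cyl R T \<equiv> cball 0 R \<times> {0<..<T}"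

lemma cyl_borel: "cyl R T \<in> sets borel"
  by (intro borel_Times) auto

lemma set_integrable_cyl:
  fixes f :: "'a::euclidean_space \<times> real \<Rightarrow> real"
  assumes "continuous_on (UNIV \<times> {0..}) f"
  shows "set_integrable lborel (cyl R T) f"
proof (rule set_integrable_subset)
  have "compact (cball (0::'a) R \<times> {0..T})" by (intro compact_Times) auto
  moreover have "continuous_on (cball (0::'a) R \<times> {0..T}) f"
    by (rule continuous_on_subset[OF assms]) auto
  ultimately show "set_integrable lborel (cball 0 R \<times> {0..T}) f"
    unfolding set_integrable_def by (rule borel_integrable_compact)
qed (use cyl_borel in auto)

text \<open>Fubini, with the indicator of \<open>A\<close> outside the slice integral, so that
  inequalities at fixed z lift to space-time.\<close>

lemma
  fixes f :: "'a::euclidean_space \<times> 'b::euclidean_space \<Rightarrow> real"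
  assumes "set_integrable lborel (A \<times> B) f"
  shows set_integral_Times:
      "(LINT x:A \<times> B|lborel. f x) = (\<integral>z. indicator A z * (LINT t:B|lborel. f (z, t)) \<partial>lborel)"
    and integrable_set_integral_Times:
      "integrable lborel (\<lambda>z. indicator A z * (LINT t:B|lborel. f (z, t)))"
proof -
  have int: "integrable (lborel \<Otimes>\<^sub>M lborel) (\<lambda>x. indicator (A \<times> B) x *\<^sub>R f x)"
    using assms by (simp add: set_integrable_def lborel_prod)
  have eq: "(\<integral>t. indicator (A \<times> B) (z, t) *\<^sub>R f (z, t) \<partial>lborel) = indicator A z * (LINT t:B|lborel. f (z, t))" for z
    by (cases "z \<in> A") (auto simp: set_lebesgue_integral_def indicator_def intro!: Bochner_Integration.integral_cong)
  show "(LINT x:A \<times> B|lborel. f x) = (\<integral>z. indicator A z * (LINT t:B|lborel. f (z, t)) \<partial>lborel)"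
    using lborel_pair.integral_fst'[OF int] by (simp only: eq set_lebesgue_integral_def[of _ "A \<times> B"] lborel_prod)
  show "integrable lborel (\<lambda>z. indicator A z * (LINT t:B|lborel. f (z, t)))"
    using lborel_pair.integrable_fst'[OF int] by (simp only: eq)
qed

lemma set_integral_cyl_const:
  assumes "T \<ge> 0"
  shows "(LINT x:(cyl R T :: ('a \<times> real) set)|lborel. (c::real)) = measure lborel (cball (0::'a::euclidean_space) R) * (T * c)"
proof -
  have "set_integrable lborel (cyl R T :: ('a \<times> real) set) (\<lambda>x. c)"
    by (intro set_integrable_cyl continuous_intros)
  note set_integral_Times[OF this]
  also have "(LINT t:{0<..<T}|lborel. c) = T * c"
    using assms by (simp add: set_lebesgue_integral_def)
  finally show ?thesis by simp
qed

text \<open>By continuity f stays above half its value at \<open>z0\<close> on a ball, and balls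
  have positive measure.\<close>

lemma integral_pos_of_pos_at:
  fixes f :: "'a::euclidean_space \<Rightarrow> real"
  assumes f: "continuous_on UNIV f" "\<And>z. f z \<ge> 0" "integrable lborel f" and z: "f z0 > 0"
  shows "(\<integral>z. f z \<partial>lborel) > 0"
proof -
  obtain d where d: "d > 0" "\<And>z. dist z z0 < d \<Longrightarrow> dist (f z) (f z0) < f z0 / 2"
    using f(1) z unfolding continuous_on_iff by (metis UNIV_I half_gt_zero)
  have "f z0 / 2 \<le> f z" if "z \<in> ball z0 d" for z
    using d(2)[of z] that by (auto simp: dist_commute dist_real_def abs_if split: if_splits)
  then have "(\<integral>z. indicator (ball z0 d) z * (f z0 / 2) \<partial>lborel) \<le> (\<integral>z. f z \<partial>lborel)"
  proof (intro integral_mono f)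
    show "integrable lborel (\<lambda>z. indicator (ball z0 d) z * (f z0 / 2))"
      using emeasure_bounded_finite[OF bounded_ball[of z0 d]]
      by (intro integrable_mult_left integrable_real_indicator) auto
  qed (use f in \<open>auto simp: indicator_def\<close>)
  moreover have "(\<integral>z. indicator (ball z0 d) z * (f z0 / 2) \<partial>lborel) = measure lborel (ball z0 d) * (f z0 / 2)"
    by simp
  moreover have "measure lborel (ball z0 d) > 0"
    using content_ball_pos[OF d(1), of z0] by simp
  ultimately show ?thesis using z by (smt (verit) half_gt_zero mult_pos_pos)
qed

section \<open>The weighted functionals J and W\<close>

lemma continuous_on_cyl_weight:
  "T > 0 \<Longrightarrow> continuous_on A f \<Longrightarrow> continuous_on A (\<lambda>x. f x * (bump R (fst x) ^ i * (1 - snd x/T) ^ j))"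
  by (intro continuous_intros) auto

text \<open>The horizon T enters twice, as the upper time limit and in the weight 1 - t/T. At T = 0
  the cylinder is empty and the value is 0.\<close>

definition Jint :: "('a::euclidean_space \<Rightarrow> real \<Rightarrow> real) \<Rightarrow> real \<Rightarrow> real \<Rightarrow> nat \<Rightarrow> real \<Rightarrow> real" where
  "Jint u p R k T = (LINT x:cyl R T|lborel. u (fst x) (snd x) powr p * (bump R (fst x) ^ k * (1 - snd x/T) ^ k))"

definition Wint :: "('a::euclidean_space \<Rightarrow> real \<Rightarrow> real) \<Rightarrow> real \<Rightarrow> nat \<Rightarrow> real \<Rightarrow> real" where
  "Wint u R k T = (LINT x:cyl R T|lborel. u (fst x) (snd x) * (bump R (fst x) ^ k * (1 - snd x/T) ^ k))"

lemma weighted_integrable: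
  fixes u :: "'a::euclidean_space \<Rightarrow> real \<Rightarrow> real"
  assumes cont: "continuous_on (UNIV \<times> {0..}) (\<lambda>(z,t). u z t)" and nn: "\<And>z t. t \<ge> 0 \<Longrightarrow> u z t \<ge> 0"
    and T: "T > 0"
  shows "set_integrable lborel (cyl R T) (\<lambda>x. u (fst x) (snd x) * (bump R (fst x) ^ i * (1 - snd x/T) ^ j))"
    and "p > 1 \<Longrightarrow> set_integrable lborel (cyl R T)
       (\<lambda>x. u (fst x) (snd x) powr p * (bump R (fst x) ^ i * (1 - snd x/T) ^ j))"
proof -
  have c: "continuous_on (UNIV \<times> {0..}) (\<lambda>x. u (fst x) (snd x))"
    using cont by (simp add: case_prod_unfold)
  then show "set_integrable lborel (cyl R T) (\<lambda>x. u (fst x) (snd x) * (bump R (fst x) ^ i * (1 - snd x/T) ^ j))"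
    by (intro set_integrable_cyl continuous_on_cyl_weight T)
  assume p: "p > 1"
  have "continuous_on (UNIV \<times> {0..}) (\<lambda>x. u (fst x) (snd x) powr p)"
    by (rule continuous_on_powr'[OF c continuous_on_const]) (use nn p in auto)
  then show "set_integrable lborel (cyl R T)
       (\<lambda>x. u (fst x) (snd x) powr p * (bump R (fst x) ^ i * (1 - snd x/T) ^ j))"
    by (intro set_integrable_cyl continuous_on_cyl_weight T)
qed

lemma set_integral_cyl_restrict:
  fixes f :: "'a::euclidean_space \<times> real \<Rightarrow> real"
  assumes "S \<le> T"
  shows "(LINT x:cyl R S|lborel. f x) = (LINT x:cyl R T|lborel. indicator (cyl R S) x * f x)"
    and "set_integrable lborel (cyl R S) f \<Longrightarrow>
           set_integrable lborel (cyl R T) (\<lambda>x. indicator (cyl R S) x * f x)"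
proof -
  have "indicator (cyl R T) x *\<^sub>R (indicator (cyl R S) x * f x) = indicator (cyl R S) x *\<^sub>R f x" for x
    using assms by (auto simp: indicator_def)
  then show "(LINT x:cyl R S|lborel. f x) = (LINT x:cyl R T|lborel. indicator (cyl R S) x * f x)"
    and "set_integrable lborel (cyl R S) f \<Longrightarrow>
           set_integrable lborel (cyl R T) (\<lambda>x. indicator (cyl R S) x * f x)"
    by (simp_all only: set_lebesgue_integral_def set_integrable_def)
qed

text \<open>Besides enlarging the cylinder, a later horizon increases the weight, since 1 - t/S
  \<le> 1 - t/T.\<close>

lemma Jint_mono:
  fixes u :: "'a::euclidean_space \<Rightarrow> real \<Rightarrow> real"
  assumes cont: "continuous_on (UNIV \<times> {0..}) (\<lambda>(z,t). u z t)" and nn: "\<And>z t. t \<ge> 0 \<Longrightarrow> u z t \<ge> 0"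
    and p: "p > 1" and S: "0 \<le> S" "S \<le> T"
  shows "Jint u p R k S \<le> Jint u p R k T"
proof (cases "S = 0")
  case True
  have "0 \<le> Jint u p R k T" unfolding Jint_def set_lebesgue_integral_def
    by (intro integral_nonneg_AE AE_I2) (auto simp: indicator_def)
  then show ?thesis using True by (simp add: Jint_def set_lebesgue_integral_def)
next
  case False
  then have pos: "S > 0" "T > 0" using S by auto
  note wS = weighted_integrable(2)[OF cont nn pos(1) p, of R k k] 
  note wT = weighted_integrable(2)[OF cont nn pos(2) p, of R k k]
  show ?thesis
    unfolding Jint_def set_integral_cyl_restrict(1)[OF S(2)]
  proof (rule set_integral_mono[OF set_integral_cyl_restrict(2)[OF S(2) wS] wT])
    fix x :: "'a \<times> real" assume x: "x \<in> cyl R T"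
    show "indicator (cyl R S) x * (u (fst x) (snd x) powr p * (bump R (fst x) ^ k * (1 - snd x / S) ^ k))
         \<le> u (fst x) (snd x) powr p * (bump R (fst x) ^ k * (1 - snd x / T) ^ k)"
    proof (cases "x \<in> cyl R S")
      case True
      then have "snd x / T \<le> snd x / S" "snd x / S \<le> 1"
        using S pos by (auto intro!: divide_left_mono)
      then have "(1 - snd x / S) ^ k \<le> (1 - snd x / T) ^ k" by (intro power_mono) auto
      then show ?thesis using True by (simp add: mult_left_mono)
    next
      case False
      then show ?thesis using x by (auto intro!: mult_nonneg_nonneg)
    qed
  qed
qed

text \<open>Before time S the integrand is kept with its time weight bounded by 1; from S on it is
  absorbed by Young's inequality. Expressing the tail through J at S and at T, instead of an
  integral over (S,T), lets the limits be taken for functions of one real variable.\<close>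

lemma Wint_split:
  fixes u :: "'a::euclidean_space \<Rightarrow> real \<Rightarrow> real"
  assumes cont: "continuous_on (UNIV \<times> {0..}) (\<lambda>(z,t). u z t)" and nn: "\<And>z t. t \<ge> 0 \<Longrightarrow> u z t \<ge> 0"
    and p: "p > 1" and S: "0 \<le> S" "S \<le> T" and T: "T > 0" and \<delta>: "\<delta> > 0"
    and k: "k > 0" "2 / (p - 1) \<le> real k"
  shows "Wint u R k T \<le> (LINT x:cyl R S|lborel. u (fst x) (snd x) * bump R (fst x) ^ k)
      + \<delta> * (Jint u p R (k+2) T - (1 - S/T) ^ (k+2) * Jint u p R (k+2) S)
      + measure lborel (cball (0::'a) R) * (T * \<delta> powr (-1/(p-1)))"
proof -
  let ?E = "\<delta> powr (-1/(p-1))"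
  define D where "D = (\<lambda>x. u (fst x) (snd x) * bump R (fst x) ^ k)"
  define F where "F = (\<lambda>S x. u (fst x) (snd x) powr p * (bump R (fst x) ^ (k+2) * (1 - snd x/S) ^ (k+2)))"
  \<comment> \<open>Extension by zero to the tall cylinder puts all integrands on one domain, so a
    pointwise inequality suffices.\<close>
  define G where "G = (\<lambda>x. indicator (cyl R S) x * D x)"
  define H where "H = (\<lambda>x. indicator (cyl R S) x * F S x)"
  have iD: "set_integrable lborel (cyl R S) D"
    unfolding D_def using cont by (intro set_integrable_cyl continuous_intros) (auto simp: case_prod_unfold)
  have iG: "set_integrable lborel (cyl R T) G"
    unfolding G_def by (rule set_integral_cyl_restrict(2)[OF S(2) iD])
  have iFT: "set_integrable lborel (cyl R T) (F T)"
    unfolding F_def by (rule weighted_integrable(2)[OF cont nn T p])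
  have iFS: "set_integrable lborel (cyl R S) (F S)"
  proof (cases "S = 0")
    case False
    then show ?thesis unfolding F_def using S by (intro weighted_integrable(2)[OF cont nn _ p]) auto
  qed (simp add: set_integrable_def)
  have iH: "set_integrable lborel (cyl R T) H"
    unfolding H_def by (rule set_integral_cyl_restrict(2)[OF S(2) iFS])
  have iE: "set_integrable lborel (cyl R T :: ('a \<times> real) set) (\<lambda>x. ?E)"
    by (intro set_integrable_cyl continuous_intros)
  have iW: "set_integrable lborel (cyl R T) (\<lambda>x. u (fst x) (snd x) * (bump R (fst x) ^ k * (1 - snd x/T) ^ k))"
    by (rule weighted_integrable(1)[OF cont nn T])
  have iC: "set_integrable lborel (cyl R T) (\<lambda>x. \<delta> * (F T x - (1 - S/T) ^ (k+2) * H x))"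
    by (intro set_integrable_mult_right set_integral_diff(1) iFT iH)
  have "Wint u R k T \<le> (LINT x:cyl R T|lborel. (G x + \<delta> * (F T x - (1 - S/T) ^ (k+2) * H x)) + ?E)"
    unfolding Wint_def
  proof (rule set_integral_mono[OF iW set_integral_add(1)[OF set_integral_add(1)[OF iG iC] iE]])
    fix x :: "'a \<times> real" assume x: "x \<in> cyl R T"
    obtain z t where zt: "x = (z, t)" by (cases x)
    have t: "0 < t" "t < T" and z: "z \<in> cball 0 R" using x by (auto simp: zt)
    have h: "0 \<le> 1 - t/T" "1 - t/T \<le> 1" using t T by auto
    have u: "0 \<le> u z t" using nn t by simp
    show "u (fst x) (snd x) * (bump R (fst x) ^ k * (1 - snd x / T) ^ k)
        \<le> (G x + \<delta> * (F T x - (1 - S/T) ^ (k+2) * H x)) + ?E"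
    proof (cases "t < S")
      case True
      then have inS: "x \<in> cyl R S" using t z by (simp add: zt)
      have "(1 - t/T) ^ k \<le> 1" using h by (intro power_le_one)
      then have "u z t * (bump R z ^ k * (1 - t/T) ^ k) \<le> u z t * (bump R z ^ k * 1)"
        using u by (intro mult_left_mono) auto
      then have 1: "u (fst x) (snd x) * (bump R (fst x) ^ k * (1 - snd x / T) ^ k) \<le> G x"
        using inS by (simp add: G_def D_def zt)
      \<comment> \<open>This comparison makes (1 - S/T)^(k+2) J(S) at most the part of J(T) before
        time S. After expansion it says 2t/T \<le> S/T + t/S.\<close>
      have "(1 - S/T) * (1 - t/S) \<le> 1 - t/T"
      proof -
        have "t/T \<le> S/T" "t/T \<le> t/S"
          using True S T t by (auto intro!: divide_right_mono divide_left_mono)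
        moreover have "(1 - S/T) * (1 - t/S) = 1 - S/T - t/S + t/T"
          using True t T by (simp add: field_simps)
        ultimately show ?thesis by linarith
      qed
      then have "((1 - S/T) * (1 - t/S)) ^ (k+2) \<le> (1 - t/T) ^ (k+2)"
        using True S T t by (intro power_mono mult_nonneg_nonneg) auto
      then have "u z t powr p * (bump R z ^ (k+2) * ((1 - S/T) * (1 - t/S)) ^ (k+2))
          \<le> u z t powr p * (bump R z ^ (k+2) * (1 - t/T) ^ (k+2))"
        by (intro mult_left_mono) auto
      also have "u z t powr p * (bump R z ^ (k+2) * ((1 - S/T) * (1 - t/S)) ^ (k+2)) = (1 - S/T) ^ (k+2) * F S x"
        by (simp only: F_def zt fst_conv snd_conv power_mult_distrib mult_ac)
      finally have "0 \<le> F T x - (1 - S/T) ^ (k+2) * H x"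
        using inS by (simp add: H_def F_def zt)
      then have "0 \<le> \<delta> * (F T x - (1 - S/T) ^ (k+2) * H x)" using \<delta> by simp
      with 1 show ?thesis by (smt (verit) powr_ge_zero)
    next
      case False
      then have GH: "G x = 0" "H x = 0" by (auto simp: G_def H_def zt)
      \<comment> \<open>Young's inequality is applied with the full space-time weight gh in the role
        of \<open>g\<close>.\<close>
      have "u z t * (bump R z * (1 - t/T)) ^ k
          \<le> \<delta> * (u z t powr p * (bump R z * (1 - t/T)) ^ (k+2)) + ?E"
        using h by (intro absorb_power p u \<delta> k mult_nonneg_nonneg mult_le_one) auto
      then show ?thesis unfolding GH
        by (simp only: F_def zt fst_conv snd_conv power_mult_distrib mult_zero_right diff_zero add_0_left)
    qed
  qed
  also have "\<dots> = (LINT x:cyl R T|lborel. G x) + \<delta> * ((LINT x:cyl R T|lborel. F T x) - (1 - S/T) ^ (k+2) * (LINT x:cyl R T|lborel. H x))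
      + (LINT x:(cyl R T :: ('a \<times> real) set)|lborel. ?E)"
    by (simp only: set_integral_add(2)[OF set_integral_add(1)[OF iG iC] iE] set_integral_add(2)[OF iG iC]
        set_integral_mult_right set_integral_diff(2)[OF iFT set_integrable_mult_right[OF iH]])
  also have "(LINT x:cyl R T|lborel. G x) = (LINT x:cyl R S|lborel. D x)"
    unfolding G_def by (rule set_integral_cyl_restrict(1)[OF S(2), symmetric])
  also have "(LINT x:cyl R T|lborel. H x) = (LINT x:cyl R S|lborel. F S x)"
    unfolding H_def by (rule set_integral_cyl_restrict(1)[OF S(2), symmetric])
  also have "(LINT x:(cyl R T :: ('a \<times> real) set)|lborel. ?E) = measure lborel (cball (0::'a) R) * (T * ?E)"
    using T by (intro set_integral_cyl_const) auto
  finally show ?thesis by (simp only: D_def F_def Jint_def)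
qed

section \<open>Testing the weak formulation and concluding\<close>

section \<open>Energy inequality and nonexistence\<close>

lemma set_integral_cyl_support:
  fixes f :: "'a::euclidean_space \<times> real \<Rightarrow> real"
  assumes "\<And>z t. z \<notin> cball 0 R \<Longrightarrow> f (z, t) = 0"
  shows "(LINT x:UNIV \<times> {0<..<T}|lborel. f x) = (LINT x:cyl R T|lborel. f x)"
  unfolding set_lebesgue_integral_def
proof (rule Bochner_Integration.integral_cong[OF refl])
  fix x :: "'a \<times> real"
  show "indicator (UNIV \<times> {0<..<T}) x *\<^sub>R f x = indicator (cyl R T) x *\<^sub>R f x"
    using assms[of "fst x" "snd x"] by (cases x) (auto simp: indicator_def)
qed

text \<open>On the cylinder u^p is bounded, so the memory term is bounded there and integrable
  against the weights. The lower bound is the fixed-z estimate multiplied by g^(k+2) and integrated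
  over the ball.\<close>

lemma
  fixes u :: "'a::euclidean_space \<Rightarrow> real \<Rightarrow> real"
  assumes g: "0 \<le> \<gamma>" "\<gamma> < 1" and p: "p > 1" and T: "T > 0"
    and cont: "continuous_on (UNIV \<times> {0..}) (\<lambda>(z,t). u z t)" and nn: "\<And>z t. t \<ge> 0 \<Longrightarrow> u z t \<ge> 0"
  shows set_integrable_weighted_memory:
      "set_integrable lborel (cyl R T) (\<lambda>x. memory \<gamma> p u (fst x) (snd x) * (bump R (fst x) ^ i * (1 - snd x/T) ^ j))"
    and memory_integral_ge:
      "T powr (1-\<gamma>) / real (k+2) * Jint u p R (k+2) T
        \<le> (LINT x:cyl R T|lborel. memory \<gamma> p u (fst x) (snd x) * (bump R (fst x) ^ (k+2) * (1 - snd x/T) ^ (k+1)))"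
proof -
  have "continuous_on (UNIV \<times> {0..}) (\<lambda>x. u (fst x) (snd x))"
    using cont by (simp add: case_prod_unfold)
  then have "continuous_on (UNIV \<times> {0..}) (\<lambda>x. u (fst x) (snd x) powr p)"
    by (rule continuous_on_powr'[OF _ continuous_on_const]) (use nn p in auto)
  then have "continuous_on (cball 0 R \<times> {0..T}) (\<lambda>x. u (fst x) (snd x) powr p)"
    by (rule continuous_on_subset) auto
  then have "bounded ((\<lambda>x. u (fst x) (snd x) powr p) ` (cball 0 R \<times> {0..T}))"
    by (intro compact_imp_bounded compact_continuous_image compact_Times) auto
  then obtain M where M: "\<And>z t. z \<in> cball 0 R \<Longrightarrow> t \<in> {0..T} \<Longrightarrow> u z t powr p \<le> M"
    unfolding bounded_iff by fastforce
  have "(\<lambda>x. memory \<gamma> p u (fst x) (snd x)) \<in> borel_measurable borel"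
    using borel_measurable_memory[OF cont, of \<gamma> p] by (simp add: case_prod_unfold)
  moreover have w: "(\<lambda>x :: 'a \<times> real. bump R (fst x) ^ i * (1 - snd x/T) ^ j) \<in> borel_measurable borel" for i j
    using T by (intro borel_measurable_continuous_onI continuous_intros) auto
  ultimately have meas: "(\<lambda>x. memory \<gamma> p u (fst x) (snd x) * (bump R (fst x) ^ i * (1 - snd x/T) ^ j)) \<in> borel_measurable borel"
    for i j by (rule borel_measurable_times)
  show int: "set_integrable lborel (cyl R T) (\<lambda>x. memory \<gamma> p u (fst x) (snd x) * (bump R (fst x) ^ i * (1 - snd x/T) ^ j))"
    for i j
  proof (rule set_integrable_bound)
    show "set_integrable lborel (cyl R T) (\<lambda>x. M * (T powr (1-\<gamma>) / (1-\<gamma>)))"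
      by (intro set_integrable_cyl continuous_intros)
    show "set_borel_measurable lborel (cyl R T)
        (\<lambda>x. memory \<gamma> p u (fst x) (snd x) * (bump R (fst x) ^ i * (1 - snd x/T) ^ j))"
      unfolding set_borel_measurable_def
      using meas cyl_borel by (intro borel_measurable_scaleR borel_measurable_indicator) auto
    have "\<bar>memory \<gamma> p u z t * (bump R z ^ i * (1 - t/T) ^ j)\<bar> \<le> \<bar>M * (T powr (1-\<gamma>) / (1-\<gamma>))\<bar>"
      if z: "z \<in> cball 0 R" and t: "t \<in> {0<..<T}" for z t
    proof -
      have t': "0 < t" "t \<le> T" using t by auto
      note mb = memory_bounds[where u=u and z=z, OF g p t' continuous_on_slice[OF cont] nn M[OF z]]
      have m: "0 \<le> memory \<gamma> p u z t" "memory \<gamma> p u z t \<le> M * (T powr (1-\<gamma>) / (1-\<gamma>))"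
        by (rule mb; assumption)+
      have "bump R z ^ i * (1 - t/T) ^ j \<le> 1"
        using t by (intro mult_le_one power_le_one) auto
      moreover have "0 \<le> bump R z ^ i * (1 - t/T) ^ j" using t by simp
      ultimately have "\<bar>memory \<gamma> p u z t * (bump R z ^ i * (1 - t/T) ^ j)\<bar> \<le> memory \<gamma> p u z t"
        using m by (simp add: abs_mult mult_left_le)
      then show ?thesis using m by linarith
    qed
    then show "AE x in lborel. x \<in> cyl R T \<longrightarrow>
        norm (memory \<gamma> p u (fst x) (snd x) * (bump R (fst x) ^ i * (1 - snd x/T) ^ j))
          \<le> norm (M * (T powr (1-\<gamma>) / (1-\<gamma>)))"
      by auto
  qed
  let ?J = "\<lambda>x. u (fst x) (snd x) powr p * (bump R (fst x) ^ (k+2) * (1 - snd x/T) ^ (k+2))"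
  let ?m = "\<lambda>x. memory \<gamma> p u (fst x) (snd x) * (bump R (fst x) ^ (k+2) * (1 - snd x/T) ^ (k+1))"
  let ?c = "T powr (1-\<gamma>) / real (k+2)"
  have iJ: "set_integrable lborel (cyl R T) (\<lambda>x. ?c * ?J x)"
    by (intro set_integrable_mult_right weighted_integrable(2)[OF cont nn T p])
  have "?c * Jint u p R (k+2) T = (LINT x:cyl R T|lborel. ?c * ?J x)"
    by (simp only: Jint_def set_integral_mult_right)
  also have "\<dots> = (\<integral>z. indicator (cball 0 R) z * (LINT t:{0<..<T}|lborel. ?c * ?J (z, t)) \<partial>lborel)"
    by (rule set_integral_Times[OF iJ])
  also have "\<dots> \<le> (\<integral>z. indicator (cball 0 R) z * (LINT t:{0<..<T}|lborel. ?m (z, t)) \<partial>lborel)"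
  proof (rule integral_mono[OF integrable_set_integral_Times[OF iJ] integrable_set_integral_Times[OF int]])
    fix z :: 'a
    have "(LINT t:{0<..<T}|lborel. ?c * ?J (z, t))
       = (LINT t:{0<..<T}|lborel. bump R z ^ (k+2) * (?c * (u z t powr p * (1 - t/T) ^ (k+1+1))))"
      by (simp add: mult_ac)
    also have "\<dots> = bump R z ^ (k+2) * (?c * (LINT t:{0<..<T}|lborel. u z t powr p * (1 - t/T) ^ (k+1+1)))"
      by (simp only: set_integral_mult_right)
    \<comment> \<open>Taking n = k+1 raises the time weight to h^(k+2), matching the power of
      g.\<close>
    also have "\<dots> \<le> bump R z ^ (k+2) * (LINT t:{0<..<T}|lborel. memory \<gamma> p u z t * (1 - t/T) ^ (k+1))"
      using weighted_memory_ge[where z=z and n="k+1", OF g p T cont nn] by (intro mult_left_mono) auto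
    also have "\<dots> = (LINT t:{0<..<T}|lborel. bump R z ^ (k+2) * (memory \<gamma> p u z t * (1 - t/T) ^ (k+1)))"
      by (simp only: set_integral_mult_right)
    also have "\<dots> = (LINT t:{0<..<T}|lborel. ?m (z, t))"
      by (simp only: fst_conv snd_conv mult_ac)
    finally show "indicator (cball 0 R) z * (LINT t:{0<..<T}|lborel. ?c * ?J (z, t))
        \<le> indicator (cball 0 R) z * (LINT t:{0<..<T}|lborel. ?m (z, t))"
      by (intro mult_left_mono) auto
  qed
  also have "\<dots> = (LINT x:cyl R T|lborel. ?m x)"
    by (rule set_integral_Times[OF int, symmetric])
  finally show "?c * Jint u p R (k+2) T \<le> (LINT x:cyl R T|lborel. ?m x)" .
qed

text \<open>The weak identity is tested with g^(k+2) h^(k+1). The memory term bounds J from below,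
  while the diffusion and time-derivative terms are controlled by W with a constant independent of
  T.\<close>

lemma energy_inequality:
  fixes u :: "((real^'n) \<times> (real^'k)) \<Rightarrow> real \<Rightarrow> real"
  assumes g: "0 \<le> \<gamma>" "\<gamma> < 1" and p: "p > 1" and T: "T \<ge> 1" and R: "R > 0" and k: "k > 0"
    and cont: "continuous_on (UNIV \<times> {0..}) (\<lambda>(z,t). u z t)" and nn: "\<And>z t. t \<ge> 0 \<Longrightarrow> u z t \<ge> 0"
    and weak: "weak_solution_on T \<gamma> p u0 u"
  shows "(\<integral>z. u0 z * bump R z ^ (k+2) \<partial>lborel) + 1 / real (k+2) * T powr (1-\<gamma>) * Jint u p R (k+2) T
    \<le> ((real CARD('n) + R\<^sup>2 * real CARD('k)) * ((4 * real (k+2) * real (k+1) + 2 * real (k+2)) / R\<^sup>2)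
        + real (k+1)) * Wint u R k T"
    (is "_ \<le> (?C + _) * _")
proof -
  have T0: "T > 0" using T by simp
  let ?\<phi> = "\<lambda>z t. bump R (z :: (real^'n) \<times> (real^'k)) ^ (k+2) * (1 - t/T) ^ (k+1)"
  let ?Dt = "\<lambda>z t. - (real (k+1) / T) * (bump R (z :: (real^'n) \<times> (real^'k)) ^ (k+2) * (1 - t/T) ^ k)"
  let ?w = "\<lambda>x :: ((real^'n) \<times> (real^'k)) \<times> real. u (fst x) (snd x) * (bump R (fst x) ^ k * (1 - snd x/T) ^ k)"
  let ?lap = "\<lambda>x. u (fst x) (snd x) * grushin_lap (bump_D2 R T k) (fst x) (snd x)"
  let ?dt = "\<lambda>x. u (fst x) (snd x) * ?Dt (fst x) (snd x)"
  have supp: "compact_supp_on T ?\<phi>"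
    unfolding compact_supp_on_def using bump_eq_0[OF R] by (intro exI[of _ "cball 0 R"]) auto
  have "- (\<integral>z. u0 z * ?\<phi> z 0 \<partial>lborel) =
          (LINT x:UNIV \<times> {0<..<T}|lborel. (\<lambda>(z,t). memory \<gamma> p u z t * ?\<phi> z t) x)
        + (LINT x:UNIV \<times> {0<..<T}|lborel. (\<lambda>(z,t). u z t * grushin_lap (bump_D2 R T k) z t) x)
        + (LINT x:UNIV \<times> {0<..<T}|lborel. (\<lambda>(z,t). u z t * ?Dt z t) x)"
    by (rule weak[unfolded weak_solution_on_def, THEN conjunct2, THEN conjunct2, rule_format,
          of ?\<phi> "bump_D1 R T k" "bump_D2 R T k" ?Dt])
       (intro conjI allI C21_bump R T0 k supp, use T0 in simp)
  also have "(LINT x:UNIV \<times> {0<..<T}|lborel. (\<lambda>(z,t). memory \<gamma> p u z t * ?\<phi> z t) x)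
      = (LINT x:cyl R T|lborel. memory \<gamma> p u (fst x) (snd x) * (bump R (fst x) ^ (k+2) * (1 - snd x/T) ^ (k+1)))"
    unfolding case_prod_unfold by (rule set_integral_cyl_support) (simp add: bump_eq_0[OF R])
  also have "(LINT x:UNIV \<times> {0<..<T}|lborel. (\<lambda>(z,t). u z t * grushin_lap (bump_D2 R T k) z t) x)
      = (LINT x:cyl R T|lborel. ?lap x)"
    unfolding case_prod_unfold
  proof (rule set_integral_cyl_support)
    fix z :: "(real^'n) \<times> (real^'k)" and t assume "z \<notin> cball 0 R"
    \<comment> \<open>The bound on the Grushin Laplacian contains g^k, which is zero outside the
      ball.\<close>
    then show "?lap (z, t) = 0"
      using grushin_lap_bump_le[OF R k, of T z t] k by (simp add: bump_eq_0[OF R] power_0_left)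
  qed
  also have "(LINT x:UNIV \<times> {0<..<T}|lborel. (\<lambda>(z,t). u z t * ?Dt z t) x) = (LINT x:cyl R T|lborel. ?dt x)"
    unfolding case_prod_unfold by (rule set_integral_cyl_support) (simp add: bump_eq_0[OF R])
  finally have weak': "(\<integral>z. u0 z * bump R z ^ (k+2) \<partial>lborel) + (LINT x:cyl R T|lborel. memory \<gamma> p u (fst x) (snd x) * (bump R (fst x) ^ (k+2) * (1 - snd x/T) ^ (k+1)))
     = - (LINT x:cyl R T|lborel. ?lap x) - (LINT x:cyl R T|lborel. ?dt x)"
    by simp
  have cu: "continuous_on (UNIV \<times> {0..}) (\<lambda>x. u (fst x) (snd x))"
    using cont by (simp add: case_prod_unfold)
  have iw: "set_integrable lborel (cyl R T) ?w" by (rule weighted_integrable(1)[OF cont nn T0])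
  have il: "set_integrable lborel (cyl R T) ?lap"
    unfolding grushin_lap_def bump_D2_def
    by (intro set_integrable_cyl continuous_intros cu) (use T0 R in auto)
  have id: "set_integrable lborel (cyl R T) ?dt"
    by (intro set_integrable_cyl continuous_intros cu) (use T0 R in auto)
  \<comment> \<open>Only lower bounds are required for this integral and the next, as both enter
    \<open>weak'\<close> with a minus sign.\<close>
  have lap: "- ?C * Wint u R k T \<le> (LINT x:cyl R T|lborel. ?lap x)"
    unfolding Wint_def set_integral_mult_right[symmetric]
  proof (rule set_integral_mono[OF set_integrable_mult_right[OF iw] il])
    fix x :: "((real^'n) \<times> (real^'k)) \<times> real" assume x: "x \<in> cyl R T"
    obtain z t where zt: "x = (z, t)" by (cases x)
    have h: "0 \<le> 1 - t/T" "1 - t/T \<le> 1" and t: "0 \<le> t" using x T0 by (auto simp: zt)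
    have "\<bar>grushin_lap (bump_D2 R T k) z t\<bar> \<le> ?C * (bump R z ^ k * (1 - t/T) ^ (k+1))"
      using grushin_lap_bump_le[OF R k, of T z t] h by simp
    also have "\<dots> \<le> ?C * (bump R z ^ k * (1 - t/T) ^ k)"
      using h by (intro mult_left_mono power_decreasing) auto
    finally have "- (?C * (bump R z ^ k * (1 - t/T) ^ k)) \<le> grushin_lap (bump_D2 R T k) z t"
      by linarith
    then have "u z t * - (?C * (bump R z ^ k * (1 - t/T) ^ k)) \<le> u z t * grushin_lap (bump_D2 R T k) z t"
      using nn[OF t] by (intro mult_left_mono)
    then show "- ?C * ?w x \<le> ?lap x" by (simp only: zt fst_conv snd_conv mult_minus_right mult_minus_left mult_ac)
  qed
  have dt: "- real (k+1) * Wint u R k T \<le> (LINT x:cyl R T|lborel. ?dt x)"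
    unfolding Wint_def set_integral_mult_right[symmetric]
  proof (rule set_integral_mono[OF set_integrable_mult_right[OF iw] id])
    fix x :: "((real^'n) \<times> (real^'k)) \<times> real" assume x: "x \<in> cyl R T"
    obtain z t where zt: "x = (z, t)" by (cases x)
    have h: "0 \<le> 1 - t/T" and t: "0 \<le> t" using x T0 by (auto simp: zt)
    \<comment> \<open>Here T \<ge> 1 removes the factor 1/T, which keeps the constant free of
      T.\<close>
    have "real (k+1) * 1 \<le> real (k+1) * T" using T by (intro mult_left_mono) auto
    then have Tle: "real (k+1) / T \<le> real (k+1)"
      using T0 by (simp only: divide_le_eq if_True mult_1_right)
    have "bump R z ^ (k+2) * (1 - t/T) ^ k \<le> bump R z ^ k * (1 - t/T) ^ k"
      using h by (intro mult_right_mono power_decreasing) auto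
    from mult_mono[OF Tle this] have "real (k+1) / T * (bump R z ^ (k+2) * (1 - t/T) ^ k)
        \<le> real (k+1) * (bump R z ^ k * (1 - t/T) ^ k)"
      using h by simp
    then have "u z t * - (real (k+1) * (bump R z ^ k * (1 - t/T) ^ k)) \<le> u z t * ?Dt z t"
      using nn[OF t] by (intro mult_left_mono) auto
    then show "- real (k+1) * ?w x \<le> ?dt x"
      by (simp only: zt fst_conv snd_conv mult_minus_right mult_minus_left mult_ac)
  qed
  have "I + Y \<le> (A + B) * W"
    if "I + M = - L - D" "- A * W \<le> L" "- B * W \<le> D" "Y \<le> M" for A B W I M L D Y :: real
    using that by (simp add: distrib_right)
  from this[OF weak' lap dt memory_integral_ge[OF g p T0 cont nn]] show ?thesis
    by (simp only: times_divide_eq_left mult_1_left)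
qed

theorem theorem3:
  fixes u0 :: "((real^'n) \<times> (real^'k)) \<Rightarrow> real" and \<gamma> p :: real
  assumes "0 \<le> \<gamma>" and "\<gamma> < 1" and "p > 1"
    and "C0 u0" and "\<forall>z. u0 z \<ge> 0" and "\<exists>z. u0 z \<noteq> 0"
    and "p * \<gamma> \<le> 1"
  shows "\<not> (\<exists>u :: ((real^'n) \<times> (real^'k)) \<Rightarrow> real \<Rightarrow> real.
            C0_path u \<and> (\<forall>z. \<forall>t\<ge>0. u z t \<ge> 0) \<and> global_weak_solution \<gamma> p u0 u)"
proof
  assume "\<exists>u :: ((real^'n) \<times> (real^'k)) \<Rightarrow> real \<Rightarrow> real.
            C0_path u \<and> (\<forall>z. \<forall>t\<ge>0. u z t \<ge> 0) \<and> global_weak_solution \<gamma> p u0 u"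
  then obtain u :: "((real^'n) \<times> (real^'k)) \<Rightarrow> real \<Rightarrow> real"
    where u: "C0_path u" "\<And>z t. t \<ge> 0 \<Longrightarrow> u z t \<ge> 0" "\<And>T. T > 0 \<Longrightarrow> weak_solution_on T \<gamma> p u0 u"
    unfolding global_weak_solution_def by blast
  note cont = C0_path_continuous_on[OF u(1)]
  obtain z0 where "u0 z0 \<noteq> 0" using assms(6) by blast
  moreover have nn0: "u0 z \<ge> 0" for z using assms(5) by (rule spec)
  ultimately have z0: "u0 z0 > 0" by (metis order_less_le)
  \<comment> \<open>Any radius beyond |z0| makes the cutoff positive at a point where the datum is
    positive.\<close>
  define R where "R = norm z0 + 1"
  have R: "R > 0" "norm z0 < R" unfolding R_def using norm_ge_zero[of z0] by linarith+
  \<comment> \<open>The ceiling gives the exponent required by \<open>absorb_power\<close>; the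
    added 1 makes \<open>k\<close> visibly positive.\<close>
  define k where "k = nat \<lceil>2 / (p - 1)\<rceil> + 1"
  have k: "k > 0" "2 / (p - 1) \<le> real k" unfolding k_def by (simp, linarith)
  define I where "I = (\<integral>z. u0 z * bump R z ^ (k+2) \<partial>lborel)"
  have cu0: "continuous_on A u0" for A
    using assms(4) by (auto simp: C0_def intro: continuous_on_subset)
  have "integrable lborel (\<lambda>z. indicator (cball 0 R) z *\<^sub>R (u0 z * bump R z ^ (k+2)))"
    by (intro borel_integrable_compact continuous_intros cu0) auto
  also have "(\<lambda>z. indicator (cball 0 R) z *\<^sub>R (u0 z * bump R z ^ (k+2))) = (\<lambda>z. u0 z * bump R z ^ (k+2))"
    using bump_eq_0[OF R(1)] by (auto simp: fun_eq_iff indicator_def)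
  finally have "I > 0"
    unfolding I_def using bump_pos[OF R(2)] z0
    by (intro integral_pos_of_pos_at[of _ z0] continuous_intros cu0 mult_nonneg_nonneg nn0) auto
  moreover have "I \<le> 0"
  proof (rule datum_nonpos[where J="Jint u p R (k+2)" and W="Wint u R k" and c="1 / real (k+2)" and m="k+2"
        and D="\<lambda>S. LINT x:cyl R S|lborel. u (fst x) (snd x) * bump R (fst x) ^ k"
        and V="measure lborel (cball (0 :: (real^'n) \<times> (real^'k)) R)"])
    show "I + 1 / real (k+2) * T powr (1-\<gamma>) * Jint u p R (k+2) T
      \<le> ((real CARD('n) + R\<^sup>2 * real CARD('k)) * ((4 * real (k+2) * real (k+1) + 2 * real (k+2)) / R\<^sup>2)
          + real (k+1)) * Wint u R k T" if "T \<ge> 1" for T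
      unfolding I_def using that by (intro energy_inequality assms R k cont u) auto
    show "0 < (real CARD('n) + R\<^sup>2 * real CARD('k)) * ((4 * real (k+2) * real (k+1) + 2 * real (k+2)) / R\<^sup>2)
          + real (k+1)"
      by (intro add_nonneg_pos mult_nonneg_nonneg divide_nonneg_nonneg) auto
    show "Jint u p R (k+2) S \<le> Jint u p R (k+2) T" if "0 \<le> S" "S \<le> T" for S T
      using that by (intro Jint_mono cont u assms)
    show "Wint u R k T \<le> (LINT x:cyl R S|lborel. u (fst x) (snd x) * bump R (fst x) ^ k)
      + \<delta> * (Jint u p R (k+2) T - (1 - S/T) ^ (k+2) * Jint u p R (k+2) S)
      + measure lborel (cball (0 :: (real^'n) \<times> (real^'k)) R) * (T * \<delta> powr (-1/(p-1)))"
      if "0 \<le> S" "S \<le> T" "1 \<le> T" "\<delta> > 0" for S T \<delta>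
      using that by (intro Wint_split cont u assms k) auto
  \<comment> \<open>Among the remaining conditions, \<open>J\<close> and \<open>D\<close> vanish at
    0 because the cylinder of height 0 is empty.\<close>
  qed (use assms in \<open>auto simp: Jint_def set_lebesgue_integral_def\<close>)
  ultimately show False by simp
qed

end
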